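(* Let $\mathcal Q$ be a quasivariety. If $\mathcal Q$ has exact (or projective) unifiers, then $\mathcal Q$ is active universally complete. If moreover $\mathcal Q$ is locally finite, then $\mathcal Q$ is active universally complete if and only if it has exact unifiers.
   Context: For a quasivariety $\mathcal Q$, $\mathbf F_{\mathcal Q}(\omega)$ is its free algebra on countably many generators. Finitely presented: isomorphic to $\mathbf F_{\mathcal Q}(X)/\theta_{\mathcal Q}(H)$ with $X,H$ finite. An algebra of $\mathcal Q$ is unifiable if it has a homomorphism into a projective algebra of $\mathcal Q$. A finitely generated algebra of $\mathcal Q$ is exact iff it is isomorphic to a subalgebra of $\mathbf F_{\mathcal Q}(\omega)$. $\mathcal Q$ has projective (resp. exact) unifiers if every finitely presented unifiable algebra in $\mathcal Q$ is projective (resp. exact). A universal sentence $\Sigma\Rightarrow\Delta$ is valid in an algebra if every assignment satisfying $\Sigma$ satisfies some equation of $\Delta$; a substitution (homomorphism from terms to $\mathbf F_{\mathcal Q}(\omega)$) unifies $\Sigma$ if it identifies both sides of all its equations; $\Sigma\Rightarrow\Delta$ is admissible if every substitution unifying $\Sigma$ unifies some equation of $\Delta$, and active if some substitution unifies $\Sigma$. $\mathcal Q$ is active universally complete if every active admissible universal sentence is valid in $\mathcal Q$. *)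

theory Defs
  imports Main "HOL-Library.FuncSet"
begin

text \<open>
  A signature is a partial map: \<open>sg f = Some n\<close> means that \<open>f\<close> is an \<open>n\<close>-ary operation symbol,
  \<open>sg f = None\<close> that \<open>f\<close> is not a symbol of the signature.  In this way the empty signature is
  covered although types are nonempty.
\<close>

type_synonym 'f signature = "'f \<rightharpoonup> nat"

datatype ('f, 'v) trm = Var 'v | Fun 'f "('f, 'v) trm list"

inductive_set trms :: "'f signature \<Rightarrow> 'v set \<Rightarrow> ('f, 'v) trm set"
  for sg :: "'f signature" and X :: "'v set" where
  Var: "x \<in> X \<Longrightarrow> Var x \<in> trms sg X"
| Fun: "sg f = Some (length ts) \<Longrightarrow> (\<And>t. t \<in> set ts \<Longrightarrow> t \<in> trms sg X) \<Longrightarrow> Fun f ts \<in> trms sg X"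

record ('f, 'a) algebra =
  carrier :: "'a set"
  interp :: "'f \<Rightarrow> 'a list \<Rightarrow> 'a"

definition subuniverse :: "'f signature \<Rightarrow> ('f, 'a) algebra \<Rightarrow> 'a set \<Rightarrow> bool" where
  "subuniverse sg A S \<longleftrightarrow> S \<subseteq> carrier A \<and>
     (\<forall>f n xs. sg f = Some n \<longrightarrow> length xs = n \<longrightarrow> set xs \<subseteq> S \<longrightarrow> interp A f xs \<in> S)"

definition is_algebra :: "'f signature \<Rightarrow> ('f, 'a) algebra \<Rightarrow> bool" where
  "is_algebra sg A \<longleftrightarrow> carrier A \<noteq> {} \<and> subuniverse sg A (carrier A)"

definition subalgebra :: "'f signature \<Rightarrow> ('f, 'a) algebra \<Rightarrow> ('f, 'a) algebra \<Rightarrow> bool" where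
  "subalgebra sg B A \<longleftrightarrow> carrier B \<noteq> {} \<and> subuniverse sg A (carrier B) \<and> interp B = interp A"

definition generated :: "'f signature \<Rightarrow> ('f, 'a) algebra \<Rightarrow> 'a set \<Rightarrow> 'a set" where
  "generated sg A G = \<Inter> {S. subuniverse sg A S \<and> G \<subseteq> S}"

definition finitely_generated :: "'f signature \<Rightarrow> ('f, 'a) algebra \<Rightarrow> bool" where
  "finitely_generated sg A \<longleftrightarrow> (\<exists>G. finite G \<and> G \<subseteq> carrier A \<and> generated sg A G = carrier A)"

definition alg_hom :: "'f signature \<Rightarrow> ('f, 'a) algebra \<Rightarrow> ('f, 'b) algebra \<Rightarrow> ('a \<Rightarrow> 'b) set" where
  "alg_hom sg A B = {h \<in> carrier A \<rightarrow> carrier B.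
     \<forall>f n xs. sg f = Some n \<longrightarrow> length xs = n \<longrightarrow> set xs \<subseteq> carrier A \<longrightarrow>
       h (interp A f xs) = interp B f (map h xs)}"

definition alg_iso :: "'f signature \<Rightarrow> ('f, 'a) algebra \<Rightarrow> ('f, 'b) algebra \<Rightarrow> bool" where
  "alg_iso sg A B \<longleftrightarrow> (\<exists>h \<in> alg_hom sg A B. bij_betw h (carrier A) (carrier B))"

definition trm_alg :: "'f signature \<Rightarrow> 'v set \<Rightarrow> ('f, ('f, 'v) trm) algebra" where
  "trm_alg sg X = \<lparr>carrier = trms sg X, interp = Fun\<rparr>"

definition congruence :: "'f signature \<Rightarrow> ('f, 'a) algebra \<Rightarrow> ('a \<times> 'a) set \<Rightarrow> bool" where
  "congruence sg A \<theta> \<longleftrightarrow> equiv (carrier A) \<theta> \<and>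
     (\<forall>f n xs ys. sg f = Some n \<longrightarrow> length xs = n \<longrightarrow> list_all2 (\<lambda>x y. (x, y) \<in> \<theta>) xs ys \<longrightarrow>
       (interp A f xs, interp A f ys) \<in> \<theta>)"

definition quotient_alg :: "('f, 'a) algebra \<Rightarrow> ('a \<times> 'a) set \<Rightarrow> ('f, 'a set) algebra" where
  "quotient_alg A \<theta> = \<lparr>carrier = carrier A // \<theta>,
     interp = (\<lambda>f Cs. \<theta> `` {interp A f (map (\<lambda>C. SOME x. x \<in> C) Cs)})\<rparr>"

fun eval :: "('f, 'a) algebra \<Rightarrow> ('v \<Rightarrow> 'a) \<Rightarrow> ('f, 'v) trm \<Rightarrow> 'a" where
  "eval A v (Var x) = v x"
| "eval A v (Fun f ts) = interp A f (map (eval A v) ts)"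

type_synonym 'f eqn = "('f, nat) trm \<times> ('f, nat) trm"

text \<open>The pair \<open>(\<Sigma>, \<Delta>)\<close> stands for the universal sentence \<open>\<Sigma> \<Rightarrow> \<Delta>\<close>.\<close>

type_synonym 'f usentence = "'f eqn set \<times> 'f eqn set"

definition universal_sentence :: "'f signature \<Rightarrow> 'f usentence \<Rightarrow> bool" where
  "universal_sentence sg \<phi> \<longleftrightarrow> finite (fst \<phi>) \<and> finite (snd \<phi>) \<and>
     fst \<phi> \<union> snd \<phi> \<subseteq> trms sg UNIV \<times> trms sg UNIV"

definition quasiequation :: "'f signature \<Rightarrow> 'f usentence \<Rightarrow> bool" where
  "quasiequation sg \<phi> \<longleftrightarrow> universal_sentence sg \<phi> \<and> card (snd \<phi>) = 1"

definition valid_in :: "('f, 'a) algebra \<Rightarrow> 'f usentence \<Rightarrow> bool" where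
  "valid_in A \<phi> \<longleftrightarrow> (\<forall>v. range v \<subseteq> carrier A \<longrightarrow>
     (\<forall>(s, t) \<in> fst \<phi>. eval A v s = eval A v t) \<longrightarrow> (\<exists>(s, t) \<in> snd \<phi>. eval A v s = eval A v t))"

text \<open>
  A quasivariety is the class of all algebras (on whatever carrier type) satisfying a given set
  \<open>E\<close> of quasiequations; it is represented by \<open>sg\<close> and \<open>E\<close>, and \<open>in_qv sg E\<close> is membership.
\<close>

definition quasivariety :: "'f signature \<Rightarrow> 'f usentence set \<Rightarrow> bool" where
  "quasivariety sg E \<longleftrightarrow> (\<forall>\<phi> \<in> E. quasiequation sg \<phi>)"

definition in_qv :: "'f signature \<Rightarrow> 'f usentence set \<Rightarrow> ('f, 'a) algebra \<Rightarrow> bool" where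
  "in_qv sg E A \<longleftrightarrow> is_algebra sg A \<and> (\<forall>\<phi> \<in> E. valid_in A \<phi>)"

text \<open>
  \<open>rel_cong sg E A H\<close> is the least relative congruence \<open>\<theta>\<^sub>\<Q>(H)\<close> of \<open>A\<close> that contains \<open>H\<close>, where a
  congruence is relative if its quotient is in the quasivariety; \<open>free_alg sg E X\<close> is the
  free algebra \<open>F\<^sub>\<Q>(X)\<close>.
\<close>

definition rel_cong ::
  "'f signature \<Rightarrow> 'f usentence set \<Rightarrow> ('f, 'a) algebra \<Rightarrow> ('a \<times> 'a) set \<Rightarrow> ('a \<times> 'a) set" where
  "rel_cong sg E A H =
     \<Inter> {\<theta>. congruence sg A \<theta> \<and> in_qv sg E (quotient_alg A \<theta>) \<and> H \<subseteq> \<theta>}"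

definition free_alg ::
  "'f signature \<Rightarrow> 'f usentence set \<Rightarrow> 'v set \<Rightarrow> ('f, ('f, 'v) trm set) algebra" where
  "free_alg sg E X = quotient_alg (trm_alg sg X) (rel_cong sg E (trm_alg sg X) {})"

abbreviation free_omega ::
  "'f signature \<Rightarrow> 'f usentence set \<Rightarrow> ('f, ('f, nat) trm set) algebra" where
  "free_omega sg E \<equiv> free_alg sg E UNIV"

definition finitely_presented ::
  "'f signature \<Rightarrow> 'f usentence set \<Rightarrow> ('f, 'a) algebra \<Rightarrow> bool" where
  "finitely_presented sg E A \<longleftrightarrow> (\<exists>(X :: nat set) H. finite X \<and> finite H \<and>
     H \<subseteq> carrier (free_alg sg E X) \<times> carrier (free_alg sg E X) \<and>
     alg_iso sg A (quotient_alg (free_alg sg E X) (rel_cong sg E (free_alg sg E X) H)))"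

text \<open>
  A quantifier over all algebras of a quasivariety has to fix a carrier type.  Below this is
  always a type that is large enough for the notion not to depend on the choice; the lemmas
  whose names end in \<open>_any_type\<close> show this.

  For \<open>P\<close> with carrier in \<open>'a\<close>, lifting along surjections between algebras on \<open>('f, 'a) trm set\<close>
  is enough, because this type has room for \<open>P\<close> and for \<open>F\<^sub>\<Q>(P)\<close>.
\<close>

definition projective :: "'f signature \<Rightarrow> 'f usentence set \<Rightarrow> ('f, 'a) algebra \<Rightarrow> bool" where
  "projective sg E P \<longleftrightarrow> in_qv sg E P \<and>
     (\<forall>(A :: ('f, ('f, 'a) trm set) algebra) (B :: ('f, ('f, 'a) trm set) algebra) g f.
        in_qv sg E A \<longrightarrow> in_qv sg E B \<longrightarrow> g \<in> alg_hom sg A B \<longrightarrow> g ` carrier A = carrier B \<longrightarrow>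
        f \<in> alg_hom sg P B \<longrightarrow> (\<exists>h \<in> alg_hom sg P A. \<forall>x \<in> carrier P. g (h x) = f x))"

text \<open>
  The type \<open>('f, nat) trm set\<close> carries \<open>F\<^sub>\<Q>(\<omega>)\<close> and a copy of every finitely generated algebra.
\<close>

definition unifiable :: "'f signature \<Rightarrow> 'f usentence set \<Rightarrow> ('f, 'a) algebra \<Rightarrow> bool" where
  "unifiable sg E A \<longleftrightarrow>
     (\<exists>P :: ('f, ('f, nat) trm set) algebra. projective sg E P \<and> alg_hom sg A P \<noteq> {})"

definition exact :: "'f signature \<Rightarrow> 'f usentence set \<Rightarrow> ('f, 'a) algebra \<Rightarrow> bool" where
  "exact sg E A \<longleftrightarrow> in_qv sg E A \<and> finitely_generated sg A \<and>
     (\<exists>B. subalgebra sg B (free_omega sg E) \<and> alg_iso sg A B)"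

definition has_projective_unifiers :: "'f signature \<Rightarrow> 'f usentence set \<Rightarrow> bool" where
  "has_projective_unifiers sg E \<longleftrightarrow> (\<forall>A :: ('f, ('f, nat) trm set) algebra.
     in_qv sg E A \<longrightarrow> finitely_presented sg E A \<longrightarrow> unifiable sg E A \<longrightarrow> projective sg E A)"

definition has_exact_unifiers :: "'f signature \<Rightarrow> 'f usentence set \<Rightarrow> bool" where
  "has_exact_unifiers sg E \<longleftrightarrow> (\<forall>A :: ('f, ('f, nat) trm set) algebra.
     in_qv sg E A \<longrightarrow> finitely_presented sg E A \<longrightarrow> unifiable sg E A \<longrightarrow> exact sg E A)"

definition locally_finite :: "'f signature \<Rightarrow> 'f usentence set \<Rightarrow> bool" where
  "locally_finite sg E \<longleftrightarrow> (\<forall>A :: ('f, ('f, nat) trm set) algebra.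
     in_qv sg E A \<longrightarrow> finitely_generated sg A \<longrightarrow> finite (carrier A))"

definition valid_in_qv :: "'f signature \<Rightarrow> 'f usentence set \<Rightarrow> 'f usentence \<Rightarrow> bool" where
  "valid_in_qv sg E \<phi> \<longleftrightarrow> (\<forall>A :: ('f, ('f, nat) trm set) algebra. in_qv sg E A \<longrightarrow> valid_in A \<phi>)"

definition substitutions ::
  "'f signature \<Rightarrow> 'f usentence set \<Rightarrow> (('f, nat) trm \<Rightarrow> ('f, nat) trm set) set" where
  "substitutions sg E = alg_hom sg (trm_alg sg UNIV) (free_omega sg E)"

definition unifies :: "(('f, nat) trm \<Rightarrow> 'b) \<Rightarrow> 'f eqn set \<Rightarrow> bool" where
  "unifies \<sigma> \<Sigma> \<longleftrightarrow> (\<forall>(s, t) \<in> \<Sigma>. \<sigma> s = \<sigma> t)"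

definition admissible :: "'f signature \<Rightarrow> 'f usentence set \<Rightarrow> 'f usentence \<Rightarrow> bool" where
  "admissible sg E \<phi> \<longleftrightarrow>
     (\<forall>\<sigma> \<in> substitutions sg E. unifies \<sigma> (fst \<phi>) \<longrightarrow> (\<exists>e \<in> snd \<phi>. unifies \<sigma> {e}))"

definition active :: "'f signature \<Rightarrow> 'f usentence set \<Rightarrow> 'f usentence \<Rightarrow> bool" where
  "active sg E \<phi> \<longleftrightarrow> (\<exists>\<sigma> \<in> substitutions sg E. unifies \<sigma> (fst \<phi>))"

definition active_universally_complete :: "'f signature \<Rightarrow> 'f usentence set \<Rightarrow> bool" where
  "active_universally_complete sg E \<longleftrightarrow> (\<forall>\<phi>. universal_sentence sg \<phi> \<longrightarrow>
     active sg E \<phi> \<longrightarrow> admissible sg E \<phi> \<longrightarrow> valid_in_qv sg E \<phi>)"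

lemma alg_homD:
  assumes "h \<in> alg_hom sg A B"
  shows "x \<in> carrier A \<Longrightarrow> h x \<in> carrier B"
    and "sg f = Some (length xs) \<Longrightarrow> set xs \<subseteq> carrier A \<Longrightarrow>
      h (interp A f xs) = interp B f (map h xs)"
  using assms by (auto simp: alg_hom_def)

lemma alg_homI:
  assumes "\<And>x. x \<in> carrier A \<Longrightarrow> h x \<in> carrier B"
    and "\<And>f xs. sg f = Some (length xs) \<Longrightarrow> set xs \<subseteq> carrier A \<Longrightarrow>
      h (interp A f xs) = interp B f (map h xs)"
  shows "h \<in> alg_hom sg A B"
  using assms by (auto simp: alg_hom_def)

lemma is_algebraD:
  assumes "is_algebra sg A"
  shows "carrier A \<noteq> {}"
    and "sg f = Some (length xs) \<Longrightarrow> set xs \<subseteq> carrier A \<Longrightarrow> interp A f xs \<in> carrier A"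
  using assms by (auto simp: is_algebra_def subuniverse_def)

lemma alg_hom_comp:
  assumes g: "g \<in> alg_hom sg A B" and h: "h \<in> alg_hom sg B C"
  shows "h \<circ> g \<in> alg_hom sg A C"
proof (rule alg_homI)
  fix f xs assume f: "sg f = Some (length xs)" "set xs \<subseteq> carrier A"
  then have "set (map g xs) \<subseteq> carrier B" using alg_homD(1)[OF g] by auto
  then show "(h \<circ> g) (interp A f xs) = interp C f (map (h \<circ> g) xs)"
    using alg_homD(2)[OF g f] alg_homD(2)[OF h, of f "map g xs"] f by simp
qed (use alg_homD(1)[OF g] alg_homD(1)[OF h] in auto)

lemma eval_closed:
  assumes "t \<in> trms sg X" "is_algebra sg A" "v ` X \<subseteq> carrier A"
  shows "eval A v t \<in> carrier A"
  using assms
proof (induction rule: trms.induct)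
  case (Fun f ts)
  have "set (map (eval A v) ts) \<subseteq> carrier A" using Fun by auto
  then show ?case using is_algebraD(2)[OF Fun.prems(1), of f "map (eval A v) ts"] Fun by simp
qed auto

lemma hom_eval:
  assumes "t \<in> trms sg X" "h \<in> alg_hom sg A B" "is_algebra sg A" "v ` X \<subseteq> carrier A"
  shows "h (eval A v t) = eval B (h \<circ> v) t"
  using assms
proof (induction rule: trms.induct)
  case (Fun f ts)
  have "set (map (eval A v) ts) \<subseteq> carrier A" 
    using Fun.hyps(2) eval_closed[OF _ Fun.prems(2,3)] by auto
  then have "h (eval A v (Fun f ts)) = interp B f (map h (map (eval A v) ts))"
    using alg_homD(2)[OF Fun.prems(1), of f "map (eval A v) ts"] Fun.hyps by simp
  also have "map h (map (eval A v) ts) = map (eval B (h \<circ> v)) ts" 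
    unfolding map_map by (rule map_cong[OF refl]) (use Fun.IH[OF _ Fun.prems] in \<open>simp only: comp_apply[of h "eval A v"]\<close>)
  finally show ?case by (simp only: eval.simps)
qed auto

lemma trm_alg_algebra: "trms sg X \<noteq> {} \<Longrightarrow> is_algebra sg (trm_alg sg X)"
  by (auto simp: is_algebra_def subuniverse_def trm_alg_def intro!: trms.Fun)

lemma eval_is_hom:
  assumes "is_algebra sg A" "v ` X \<subseteq> carrier A"
  shows "eval A v \<in> alg_hom sg (trm_alg sg X) A"
  using eval_closed[OF _ assms] by (intro alg_homI) (auto simp: trm_alg_def)

lemma eval_trm_alg: "eval (trm_alg sg X) Var t = t"
  by (induction t) (auto simp: trm_alg_def intro: map_idI)

lemma usentence_trms:
  "universal_sentence sg \<phi> \<Longrightarrow> (s, t) \<in> fst \<phi> \<union> snd \<phi> \<Longrightarrow> s \<in> trms sg UNIV \<and> t \<in> trms sg UNIV"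
  by (auto simp: universal_sentence_def)

lemma valid_in_embed:
  assumes h: "h \<in> alg_hom sg B A" and inj: "inj_on h (carrier B)" and B: "is_algebra sg B"
    and \<phi>: "universal_sentence sg \<phi>" and A: "valid_in A \<phi>"
  shows "valid_in B \<phi>"
  unfolding valid_in_def
proof (intro allI impI)
  fix v assume v: "range v \<subseteq> carrier B" and *: "\<forall>(s, t) \<in> fst \<phi>. eval B v s = eval B v t"
  have eq: "eval A (h \<circ> v) s = eval A (h \<circ> v) t \<longleftrightarrow> eval B v s = eval B v t"
    if "(s, t) \<in> fst \<phi> \<union> snd \<phi>" for s t
    using hom_eval[OF _ h B v] eval_closed[OF _ B v] usentence_trms[OF \<phi> that] inj
    by (metis inj_onD)
  have "range (h \<circ> v) \<subseteq> carrier A" using v alg_homD(1)[OF h] by auto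
  moreover have "\<forall>(s, t) \<in> fst \<phi>. eval A (h \<circ> v) s = eval A (h \<circ> v) t" using * eq by blast
  ultimately have "\<exists>(s, t) \<in> snd \<phi>. eval A (h \<circ> v) s = eval A (h \<circ> v) t"
    using A unfolding valid_in_def by blast
  then show "\<exists>(s, t) \<in> snd \<phi>. eval B v s = eval B v t" using eq by blast
qed

lemma in_qv_embed:
  assumes "quasivariety sg E" "h \<in> alg_hom sg B A" "inj_on h (carrier B)" "is_algebra sg B" "in_qv sg E A"
  shows "in_qv sg E B"
  using assms valid_in_embed[OF assms(2-4)] unfolding in_qv_def quasivariety_def quasiequation_def
  by blast

lemma inverse_hom:
  assumes A: "is_algebra sg A" and h: "h \<in> alg_hom sg A B" "bij_betw h (carrier A) (carrier B)"
  shows "inv_into (carrier A) h \<in> alg_hom sg B A"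
proof (rule alg_homI)
  let ?k = "inv_into (carrier A) h"
  have k: "bij_betw ?k (carrier B) (carrier A)" using h(2) by (rule bij_betw_inv_into)
  show "?k y \<in> carrier A" if "y \<in> carrier B" for y using k that by (auto dest: bij_betwE)
  fix f ys assume f: "sg f = Some (length ys)" "set ys \<subseteq> carrier B"
  have ks: "set (map ?k ys) \<subseteq> carrier A" using f k by (auto dest: bij_betwE)
  have "map h (map ?k ys) = ys"
    using f h(2) by (auto intro!: map_idI simp: bij_betw_inv_into_right)
  then have "h (interp A f (map ?k ys)) = interp B f ys"
    using alg_homD(2)[OF h(1), of f "map ?k ys"] ks f by simp
  then show "?k (interp B f ys) = interp A f (map ?k ys)"
    using is_algebraD(2)[OF A, of f "map ?k ys"] ks f h(2)
    by (metis bij_betw_inv_into_left length_map)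
qed

lemma alg_iso_sym: "alg_iso sg A B \<Longrightarrow> is_algebra sg A \<Longrightarrow> alg_iso sg B A"
  unfolding alg_iso_def using inverse_hom bij_betw_inv_into by blast

lemma alg_iso_trans: "alg_iso sg A B \<Longrightarrow> alg_iso sg B C \<Longrightarrow> alg_iso sg A C"
  unfolding alg_iso_def by (blast intro: alg_hom_comp bij_betw_trans)

lemma in_qv_iso:
  assumes "quasivariety sg E" "alg_iso sg A B" "is_algebra sg A" "in_qv sg E B"
  shows "in_qv sg E A"
  using assms(2) in_qv_embed[OF assms(1) _ _ assms(3,4)] unfolding alg_iso_def bij_betw_def by blast

lemma fg_image:
  assumes h: "h \<in> alg_hom sg A B" and s: "h ` carrier A = carrier B"
    and A: "subuniverse sg A (carrier A)" and fg: "finitely_generated sg A"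
  shows "finitely_generated sg B"
proof -
  obtain G where G: "finite G" "G \<subseteq> carrier A" "generated sg A G = carrier A"
    using fg by (auto simp: finitely_generated_def)
  have "carrier B \<subseteq> S" if S: "subuniverse sg B S" "h ` G \<subseteq> S" for S
  proof -
    let ?T = "{a \<in> carrier A. h a \<in> S}"
    have "subuniverse sg A ?T"
      unfolding subuniverse_def
    proof (intro conjI allI impI)
      fix f n xs assume f: "sg f = Some n" "length xs = n" "set xs \<subseteq> ?T"
      have "h (interp A f xs) = interp B f (map h xs)"
        using alg_homD(2)[OF h, of f xs] f by auto
      moreover have "set (map h xs) \<subseteq> S" using f by auto
      ultimately show "interp A f xs \<in> ?T"
        using f S(1) A unfolding subuniverse_def by force
    qed auto
    then have "generated sg A G \<subseteq> ?T" using G S unfolding generated_def by blast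
    then have "\<forall>a \<in> carrier A. h a \<in> S" using G(3) by blast
    then show ?thesis unfolding s[symmetric] by auto
  qed
  moreover have "subuniverse sg B (carrier B)"
    unfolding subuniverse_def
  proof (intro conjI allI impI)
    fix f n ys assume f: "sg f = Some n" "length ys = n" "set ys \<subseteq> carrier B"
    then have "ys \<in> lists (h ` carrier A)" using s by auto
    then obtain xs where xs: "ys = map h xs" "set xs \<subseteq> carrier A"
      unfolding lists_image by auto
    then have "interp B f ys = h (interp A f xs)" using alg_homD(2)[OF h, of f xs] f by auto
    moreover have "interp A f xs \<in> carrier A" using A f xs unfolding subuniverse_def by auto
    ultimately show "interp B f ys \<in> carrier B" using alg_homD(1)[OF h] by auto
  qed auto
  ultimately have "generated sg B (h ` G) = carrier B"
    using image_mono[OF G(2), of h] unfolding s generated_def by blast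
  moreover have "h ` G \<subseteq> carrier B" using image_mono[OF G(2), of h] unfolding s .
  ultimately show ?thesis using G(1) unfolding finitely_generated_def by blast
qed

lemma fg_iso:
  assumes "alg_iso sg A B" "is_algebra sg A" "finitely_generated sg A"
  shows "finitely_generated sg B"
  using assms(1,2) fg_image[OF _ _ _ assms(3)] unfolding alg_iso_def bij_betw_def is_algebra_def
  by blast

lemma fg_trm_alg: "finite X \<Longrightarrow> finitely_generated sg (trm_alg sg X)"
proof -
  assume fin: "finite X"
  have su: "subuniverse sg (trm_alg sg X) (trms sg X)"
    by (auto simp: subuniverse_def trm_alg_def intro!: trms.Fun)
  have "t \<in> S" if S: "subuniverse sg (trm_alg sg X) S" "Var ` X \<subseteq> S" and t: "t \<in> trms sg X" for S t
    using t
  proof (induction rule: trms.induct)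
    case (Fun f ts)
    then have "set ts \<subseteq> S" by auto
    then show ?case using S(1) Fun.hyps(1) by (auto simp: subuniverse_def trm_alg_def)
  qed (use S in auto)
  moreover have "Var ` X \<subseteq> trms sg X" by (auto intro: trms.Var)
  ultimately have "generated sg (trm_alg sg X) (Var ` X) = trms sg X" "Var ` X \<subseteq> trms sg X"
    using su unfolding generated_def by blast+
  then show ?thesis using fin by (auto simp: finitely_generated_def trm_alg_def)
qed

lemma eval_image_subuniverse:
  assumes A: "is_algebra sg A" and v: "v ` X \<subseteq> carrier A"
  shows "subuniverse sg A (eval A v ` trms sg X)"
  unfolding subuniverse_def
proof (intro conjI allI impI)
  show "eval A v ` trms sg X \<subseteq> carrier A" using eval_closed[OF _ A v] by auto
  fix f n ys assume f: "sg f = Some n" "length ys = n" "set ys \<subseteq> eval A v ` trms sg X"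
  then have "ys \<in> lists (eval A v ` trms sg X)" by auto
  then obtain ts where ts: "ys = map (eval A v) ts" "set ts \<subseteq> trms sg X"
    unfolding lists_image by auto
  then have "Fun f ts \<in> trms sg X" using f by (auto intro: trms.Fun)
  then show "interp A f ys \<in> eval A v ` trms sg X" using ts by (force intro: image_eqI[of _ _ "Fun f ts"])
qed

lemma fg_eval:
  assumes A: "is_algebra sg A" and fg: "finitely_generated sg A"
  obtains v :: "nat \<Rightarrow> 'a" where "range v \<subseteq> carrier A" "eval A v ` trms sg UNIV = carrier (A :: ('f, 'a) algebra)"
proof -
  obtain G where G: "finite G" "G \<subseteq> carrier A" "generated sg A G = carrier A"
    using fg by (auto simp: finitely_generated_def)
  obtain a where a: "a \<in> carrier A" using is_algebraD(1)[OF A] by auto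
  obtain xs where xs: "set xs = G" using finite_list[OF G(1)] by auto
  define v where "v i = (if i < length xs then xs ! i else a)" for i
  have v: "range v \<subseteq> carrier A" using a xs G by (auto simp: v_def)
  have "G \<subseteq> eval A v ` trms sg UNIV"
  proof
    fix x assume "x \<in> G"
    then obtain i where "v i = x" using xs unfolding v_def in_set_conv_nth[symmetric] by (metis in_set_conv_nth)
    then show "x \<in> eval A v ` trms sg UNIV"
      by (intro image_eqI[of _ _ "Var i"]) (auto intro: trms.Var)
  qed
  then have "generated sg A G \<subseteq> eval A v ` trms sg UNIV"
    using eval_image_subuniverse[OF A v] by (auto simp: generated_def)
  then show ?thesis using that[OF v] G eval_closed[OF _ A v] by blast
qed

lemma copy_exists:
  assumes inj: "inj_on m (carrier A)" and A: "is_algebra sg A"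
  obtains B where "is_algebra sg B" "m \<in> alg_hom sg A B" "bij_betw m (carrier A) (carrier B)"
proof -
  let ?k = "inv_into (carrier A) m"
  let ?B = "\<lparr>carrier = m ` carrier A, interp = (\<lambda>f ys. m (interp A f (map ?k ys)))\<rparr>"
  have k: "map ?k (map m xs) = xs" if "set xs \<subseteq> carrier A" for xs
    using that inj by (auto intro!: map_idI)
  have "is_algebra sg ?B"
    unfolding is_algebra_def subuniverse_def
  proof (intro conjI allI impI)
    fix f n ys assume f: "sg f = Some n" "length ys = n" "set ys \<subseteq> carrier ?B"
    have "set (map ?k ys) \<subseteq> carrier A" using f by (auto intro: inv_into_into)
    then show "interp ?B f ys \<in> carrier ?B"
      using is_algebraD(2)[OF A, of f "map ?k ys"] f by simp
  qed (use is_algebraD(1)[OF A] in auto)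
  moreover have "m \<in> alg_hom sg A ?B" by (rule alg_homI) (auto simp: k simp del: map_map)
  moreover have "bij_betw m (carrier A) (carrier ?B)" using inj by (simp add: bij_betw_def)
  ultimately show ?thesis by (rule that)
qed

lemma countable_copy:
  fixes A :: "('f, 'a) algebra" and v :: "nat \<Rightarrow> 'a"
  assumes Q: "quasivariety sg E" and A: "in_qv sg E A" and v: "range v \<subseteq> carrier A"
  obtains B :: "('f, ('f, nat) trm set) algebra"
    where "in_qv sg E B" "alg_iso sg (A\<lparr>carrier := eval A v ` trms sg UNIV\<rparr>) B"
      "is_algebra sg (A\<lparr>carrier := eval A v ` trms sg UNIV\<rparr>)"
proof -
  let ?C = "A\<lparr>carrier := eval A v ` trms sg UNIV\<rparr>"
  have alg: "is_algebra sg A" using A by (simp add: in_qv_def)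
  have C: "is_algebra sg ?C"
    using eval_image_subuniverse[OF alg v] trms.Var[of "0 :: nat" UNIV sg]
    by (auto simp: is_algebra_def subuniverse_def)
  have "id \<in> alg_hom sg ?C A" using eval_closed[OF _ alg v] by (auto intro!: alg_homI)
  then have CQ: "in_qv sg E ?C" using in_qv_embed[OF Q _ _ C A] by auto
  let ?m = "\<lambda>a. {t \<in> trms sg UNIV. eval A v t = a}"
  have "inj_on ?m (carrier ?C)" by (auto simp: inj_on_def)
  then obtain B where B: "is_algebra sg B" "?m \<in> alg_hom sg ?C B" "bij_betw ?m (carrier ?C) (carrier B)"
    using copy_exists[OF _ C] by blast
  then have iso: "alg_iso sg ?C B" by (auto simp: alg_iso_def)
  show ?thesis by (rule that[OF in_qv_iso[OF Q alg_iso_sym[OF iso C] B(1) CQ] iso C])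
qed

lemma fg_copy:
  fixes A :: "('f, 'a) algebra"
  assumes Q: "quasivariety sg E" and A: "in_qv sg E A" and fg: "finitely_generated sg A"
  obtains B :: "('f, ('f, nat) trm set) algebra" where "in_qv sg E B" "alg_iso sg A B"
proof -
  have alg: "is_algebra sg A" using A by (simp add: in_qv_def)
  obtain v :: "nat \<Rightarrow> 'a" where v: "range v \<subseteq> carrier A" "eval A v ` trms sg UNIV = carrier A"
    using fg_eval[OF alg fg] by blast
  show ?thesis using countable_copy[OF Q A v(1)] that v(2) by auto
qed

lemma locally_finite_any_type:
  fixes A :: "('f, 'a) algebra"
  assumes Q: "quasivariety sg E" and "locally_finite sg E" "in_qv sg E A" "finitely_generated sg A"
  shows "finite (carrier A)"
proof -
  obtain B :: "('f, ('f, nat) trm set) algebra" where B: "in_qv sg E B" "alg_iso sg A B"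
    using fg_copy assms by blast
  then have "finite (carrier B)"
    using assms fg_iso unfolding locally_finite_def by (metis in_qv_def)
  then show ?thesis using B(2) by (auto simp: alg_iso_def bij_betw_finite)
qed

lemma valid_in_qv_any_type:
  fixes A :: "('f, 'a) algebra"
  assumes Q: "quasivariety sg E" and \<phi>: "universal_sentence sg \<phi>"
    and valid: "valid_in_qv sg E \<phi>" and A: "in_qv sg E A"
  shows "valid_in A \<phi>"
  unfolding valid_in_def
proof (intro allI impI)
  fix v assume v: "range v \<subseteq> carrier A" and *: "\<forall>(s, t) \<in> fst \<phi>. eval A v s = eval A v t"
  let ?C = "A\<lparr>carrier := eval A v ` trms sg UNIV\<rparr>"
  obtain B :: "('f, ('f, nat) trm set) algebra"
    where B: "in_qv sg E B" "alg_iso sg ?C B" "is_algebra sg ?C"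
    using countable_copy[OF Q A v] by blast
  have "valid_in B \<phi>" using valid B(1) by (simp add: valid_in_qv_def)
  then have C: "valid_in ?C \<phi>"
    using B valid_in_embed[OF _ _ B(3) \<phi>] by (auto simp: alg_iso_def bij_betw_def)
  have ev: "eval ?C v t = eval A v t" for t
    by (induction t) (auto cong: map_cong)
  have "v i \<in> eval A v ` trms sg UNIV" for i
    by (rule image_eqI[of _ _ "Var i"]) (auto intro: trms.Var)
  then have "range v \<subseteq> carrier ?C" by auto
  moreover have "\<forall>(s, t) \<in> fst \<phi>. eval ?C v s = eval ?C v t" using * by (simp only: ev)
  ultimately have "\<exists>(s, t) \<in> snd \<phi>. eval ?C v s = eval ?C v t"
    using C[unfolded valid_in_def, rule_format, of v] by simp
  then show "\<exists>(s, t) \<in> snd \<phi>. eval A v s = eval A v t" by (simp only: ev)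
qed

lemma quotient_hom:
  assumes A: "is_algebra sg A" and c: "congruence sg A \<theta>"
  shows "(\<lambda>a. \<theta> `` {a}) \<in> alg_hom sg A (quotient_alg A \<theta>)"
    and "(\<lambda>a. \<theta> `` {a}) ` carrier A = carrier (quotient_alg A \<theta>)"
    and "is_algebra sg (quotient_alg A \<theta>)"
proof -
  have eq: "equiv (carrier A) \<theta>" using c by (simp add: congruence_def)
  let ?q = "\<lambda>a. \<theta> `` {a}" and ?r = "\<lambda>C. SOME x. x \<in> C"
  have r: "(a, ?r (?q a)) \<in> \<theta>" if "a \<in> carrier A" for a
    using someI[of "\<lambda>x. x \<in> ?q a" a] equiv_class_self[OF eq that] by auto
  show hom: "?q \<in> alg_hom sg A (quotient_alg A \<theta>)"
  proof (rule alg_homI)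
    fix f xs assume f: "sg f = Some (length xs)" "set xs \<subseteq> carrier A"
    have "list_all2 (\<lambda>x y. (x, y) \<in> \<theta>) xs (map ?r (map ?q xs))"
      using f r by (auto simp: list_all2_conv_all_nth subset_iff)
    then have "(interp A f xs, interp A f (map ?r (map ?q xs))) \<in> \<theta>"
      using c f unfolding congruence_def by blast
    then show "?q (interp A f xs) = interp (quotient_alg A \<theta>) f (map ?q xs)"
      using equiv_class_eq[OF eq] by (simp add: quotient_alg_def)
  qed (auto simp: quotient_alg_def quotientI)
  show surj: "?q ` carrier A = carrier (quotient_alg A \<theta>)"
    by (auto simp: quotient_alg_def quotient_def)
  show "is_algebra sg (quotient_alg A \<theta>)"
    unfolding is_algebra_def subuniverse_def
  proof (intro conjI allI impI)
    show "carrier (quotient_alg A \<theta>) \<noteq> {}" using surj is_algebraD(1)[OF A] by auto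
    fix f n ys assume f: "sg f = Some n" "length ys = n" "set ys \<subseteq> carrier (quotient_alg A \<theta>)"
    then have "ys \<in> lists (?q ` carrier A)" using surj by auto
    then obtain xs where xs: "ys = map ?q xs" "set xs \<subseteq> carrier A"
      unfolding lists_image by auto
    then have "interp (quotient_alg A \<theta>) f ys = ?q (interp A f xs)"
      using alg_homD(2)[OF hom, of f xs] f by auto
    then show "interp (quotient_alg A \<theta>) f ys \<in> carrier (quotient_alg A \<theta>)"
      using is_algebraD(2)[OF A, of f xs] f xs alg_homD(1)[OF hom] by auto
  qed auto
qed

lemma valid_quotient:
  assumes A: "is_algebra sg A" and c: "congruence sg A \<theta>" and \<phi>: "universal_sentence sg \<phi>"
  shows "valid_in (quotient_alg A \<theta>) \<phi> \<longleftrightarrow> (\<forall>v. range v \<subseteq> carrier A \<longrightarrow>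
     (\<forall>(s, t) \<in> fst \<phi>. (eval A v s, eval A v t) \<in> \<theta>) \<longrightarrow>
     (\<exists>(s, t) \<in> snd \<phi>. (eval A v s, eval A v t) \<in> \<theta>))" (is "?L = ?R")
proof -
  let ?q = "\<lambda>a. \<theta> `` {a}" and ?A = "quotient_alg A \<theta>"
  note hom = quotient_hom(1)[OF A c] and surj = quotient_hom(2)[OF A c]
  have eq: "equiv (carrier A) \<theta>" using c by (simp add: congruence_def)
  have ev: "eval ?A (?q \<circ> v) s = eval ?A (?q \<circ> v) t \<longleftrightarrow> (eval A v s, eval A v t) \<in> \<theta>"
    if "(s, t) \<in> fst \<phi> \<union> snd \<phi>" "range v \<subseteq> carrier A" for s t v
  proof -
    have st: "s \<in> trms sg UNIV" "t \<in> trms sg UNIV" using usentence_trms[OF \<phi> that(1)] by auto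
    show ?thesis
      using hom_eval[OF st(1) hom A that(2)] hom_eval[OF st(2) hom A that(2)]
        eq_equiv_class_iff[OF eq eval_closed[OF st(1) A that(2)] eval_closed[OF st(2) A that(2)]]
      by simp
  qed
  have lift: "\<exists>v. range v \<subseteq> carrier A \<and> w = ?q \<circ> v" if "range w \<subseteq> carrier ?A" for w :: "nat \<Rightarrow> _"
  proof -
    have "\<forall>i. \<exists>a. a \<in> carrier A \<and> w i = ?q a" using that surj by blast
    then obtain v where "\<forall>i. v i \<in> carrier A \<and> w i = ?q (v i)" by metis
    then show ?thesis by (intro exI[of _ v]) auto
  qed
  have sub: "range (?q \<circ> v) \<subseteq> carrier ?A" if "range v \<subseteq> carrier A" for v :: "nat \<Rightarrow> _"
    using that surj by auto
  show ?thesis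
  proof
    assume L: ?L
    show ?R
    proof (intro allI impI)
      fix v :: "nat \<Rightarrow> 'b" assume v: "range v \<subseteq> carrier A"
        and "\<forall>(s, t) \<in> fst \<phi>. (eval A v s, eval A v t) \<in> \<theta>"
      then have "\<forall>(s, t) \<in> fst \<phi>. eval ?A (?q \<circ> v) s = eval ?A (?q \<circ> v) t" using ev[OF _ v] by blast
      then have "\<exists>(s, t) \<in> snd \<phi>. eval ?A (?q \<circ> v) s = eval ?A (?q \<circ> v) t"
        using L sub[OF v] unfolding valid_in_def by blast
      then show "\<exists>(s, t) \<in> snd \<phi>. (eval A v s, eval A v t) \<in> \<theta>" using ev[OF _ v] by blast
    qed
  next
    assume R: ?R
    show ?L
      unfolding valid_in_def
    proof (intro allI impI)
      fix w assume w: "range w \<subseteq> carrier ?A" and *: "\<forall>(s, t) \<in> fst \<phi>. eval ?A w s = eval ?A w t"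
      obtain v where v: "range v \<subseteq> carrier A" "w = ?q \<circ> v" using lift[OF w] by blast
      have "\<forall>(s, t) \<in> fst \<phi>. (eval A v s, eval A v t) \<in> \<theta>"
        using * ev[OF _ v(1)] unfolding v(2) by blast
      then have "\<exists>(s, t) \<in> snd \<phi>. (eval A v s, eval A v t) \<in> \<theta>" using R v(1) by blast
      then show "\<exists>(s, t) \<in> snd \<phi>. eval ?A w s = eval ?A w t"
        using ev[OF _ v(1)] unfolding v(2) by blast
    qed
  qed
qed

lemma rel_cong:
  assumes Q: "quasivariety sg E" and A: "is_algebra sg A" and H: "H \<subseteq> carrier A \<times> carrier A"
  shows "congruence sg A (rel_cong sg E A H)" (is ?C)
    and "in_qv sg E (quotient_alg A (rel_cong sg E A H))" (is ?I)
proof -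
  let ?R = "{\<theta>. congruence sg A \<theta> \<and> in_qv sg E (quotient_alg A \<theta>) \<and> H \<subseteq> \<theta>}"
  let ?T = "carrier A \<times> carrier A"
  have qe: "universal_sentence sg \<phi> \<and> card (snd \<phi>) = 1" if "\<phi> \<in> E" for \<phi>
    using Q that by (simp add: quasivariety_def quasiequation_def)
  have T: "congruence sg A ?T"
    using A by (auto simp: congruence_def equiv_def refl_on_def sym_def trans_def list_all2_conv_all_nth
        in_set_conv_nth subset_iff intro!: is_algebraD(2)[OF A])
  have "valid_in (quotient_alg A ?T) \<phi>" if "\<phi> \<in> E" for \<phi>
  proof -
    obtain s t where st: "snd \<phi> = {(s, t)}" using qe[OF \<open>\<phi> \<in> E\<close>] by (metis surj_pair card_1_singletonE)
    have "(s, t) \<in> fst \<phi> \<union> snd \<phi>" using st by simp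
    then have "s \<in> trms sg UNIV" "t \<in> trms sg UNIV" using usentence_trms qe[OF that] by blast+
    then show ?thesis
      unfolding valid_quotient[OF A T conjunct1[OF qe[OF that]]] using st eval_closed[OF _ A] by auto
  qed
  then have TR: "?T \<in> ?R" using T H quotient_hom(3)[OF A T] by (auto simp: in_qv_def)
  show C: ?C
    unfolding congruence_def
  proof (intro conjI allI impI)
    show "equiv (carrier A) (rel_cong sg E A H)"
      unfolding equiv_def
    proof (intro conjI)
      show "rel_cong sg E A H \<subseteq> ?T" using TR by (auto simp: rel_cong_def)
      show "refl_on (carrier A) (rel_cong sg E A H)"
        by (auto simp: rel_cong_def refl_on_def congruence_def equiv_def)
      show "sym (rel_cong sg E A H)"
        by (auto simp: rel_cong_def sym_def congruence_def equiv_def)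
      show "trans (rel_cong sg E A H)"
        unfolding rel_cong_def
      proof (intro transI InterI)
        fix x y z \<theta> assume xy: "(x, y) \<in> \<Inter> ?R" and yz: "(y, z) \<in> \<Inter> ?R" and \<theta>: "\<theta> \<in> ?R"
        have "(x, y) \<in> \<theta>" "(y, z) \<in> \<theta>" using xy yz \<theta> by blast+
        moreover have "trans \<theta>" using \<theta> by (simp add: congruence_def equiv_def)
        ultimately show "(x, z) \<in> \<theta>" by (meson transD)
      qed
    qed
    fix f n xs ys assume f: "sg f = Some n" "length xs = n"
      "list_all2 (\<lambda>x y. (x, y) \<in> rel_cong sg E A H) xs ys"
    show "(interp A f xs, interp A f ys) \<in> rel_cong sg E A H"
      unfolding rel_cong_def
    proof (intro InterI)
      fix \<theta> assume \<theta>: "\<theta> \<in> ?R"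
      have "list_all2 (\<lambda>x y. (x, y) \<in> \<theta>) xs ys"
        using f(3) by (rule list_all2_mono) (use \<theta> in \<open>auto simp: rel_cong_def\<close>)
      then show "(interp A f xs, interp A f ys) \<in> \<theta>"
        using \<theta> f unfolding congruence_def by blast
    qed
  qed
  have "valid_in (quotient_alg A (rel_cong sg E A H)) \<phi>" if "\<phi> \<in> E" for \<phi>
  proof -
    note us = conjunct1[OF qe[OF that]]
    obtain s t where st: "snd \<phi> = {(s, t)}" using qe[OF \<open>\<phi> \<in> E\<close>] by (metis surj_pair card_1_singletonE)
    show ?thesis
      unfolding valid_quotient[OF A C us]
    proof (intro allI impI)
      fix v :: "nat \<Rightarrow> 'b" assume v: "range v \<subseteq> carrier A"
        and *: "\<forall>(s, t) \<in> fst \<phi>. (eval A v s, eval A v t) \<in> rel_cong sg E A H"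
      have "(eval A v s, eval A v t) \<in> \<theta>" if \<theta>: "\<theta> \<in> ?R" for \<theta>
      proof -
        have c: "congruence sg A \<theta>" and "valid_in (quotient_alg A \<theta>) \<phi>"
          using \<theta> \<open>\<phi> \<in> E\<close> by (auto simp: in_qv_def)
        moreover have "\<forall>(s, t) \<in> fst \<phi>. (eval A v s, eval A v t) \<in> \<theta>"
          using * \<theta> unfolding rel_cong_def by blast
        ultimately show ?thesis using v st unfolding valid_quotient[OF A c us] by auto
      qed
      then show "\<exists>(s, t) \<in> snd \<phi>. (eval A v s, eval A v t) \<in> rel_cong sg E A H"
        using st by (auto simp: rel_cong_def)
    qed
  qed
  then show ?I using quotient_hom(3)[OF A C] by (simp add: in_qv_def)
qed

lemma kernel_congruence:
  assumes h: "h \<in> alg_hom sg A B" and A: "is_algebra sg A"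
  shows "congruence sg A {(x, y) \<in> carrier A \<times> carrier A. h x = h y}" (is "congruence sg A ?\<theta>")
  unfolding congruence_def
proof (intro conjI allI impI)
  show "equiv (carrier A) ?\<theta>"
    by (auto simp: equiv_def refl_on_def sym_def trans_def)
  fix f n xs ys assume f: "sg f = Some n" "length xs = n" "list_all2 (\<lambda>x y. (x, y) \<in> ?\<theta>) xs ys"
  then have "length ys = n" "set xs \<subseteq> carrier A" "set ys \<subseteq> carrier A" "map h xs = map h ys"
    by (auto simp: list_all2_conv_all_nth in_set_conv_nth intro: nth_equalityI)
  then show "(interp A f xs, interp A f ys) \<in> ?\<theta>"
    using f is_algebraD(2)[OF A, of f] alg_homD(2)[OF h, of f] by auto
qed

lemma factor_hom:
  assumes A: "is_algebra sg A" and c: "congruence sg A \<theta>" and h: "h \<in> alg_hom sg A B"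
    and le: "\<And>x y. (x, y) \<in> \<theta> \<Longrightarrow> h x = h y"
  obtains k where "k \<in> alg_hom sg (quotient_alg A \<theta>) B"
    "\<And>a. a \<in> carrier A \<Longrightarrow> k (\<theta> `` {a}) = h a"
proof -
  let ?k = "\<lambda>C. h (SOME x. x \<in> C)"
  have eq: "equiv (carrier A) \<theta>" using c by (simp add: congruence_def)
  have k: "?k (\<theta> `` {a}) = h a" if "a \<in> carrier A" for a
    
  proof -
    have "(SOME x. x \<in> \<theta> `` {a}) \<in> \<theta> `` {a}" by (rule someI) (rule equiv_class_self[OF eq that])
    then have "(a, SOME x. x \<in> \<theta> `` {a}) \<in> \<theta>" by (rule ImageE) simp
    from le[OF this] show ?thesis by (rule sym)
  qed
  note hom = quotient_hom(1)[OF A c] and surj = quotient_hom(2)[OF A c]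
  have "?k \<in> alg_hom sg (quotient_alg A \<theta>) B"
  proof (rule alg_homI)
    fix C assume "C \<in> carrier (quotient_alg A \<theta>)"
    then obtain a where a: "a \<in> carrier A" "C = \<theta> `` {a}" unfolding surj[symmetric] by blast
    show "?k C \<in> carrier B" unfolding a(2) k[OF a(1)] by (rule alg_homD(1)[OF h a(1)])
  next
    fix f ys assume f: "sg f = Some (length ys)" "set ys \<subseteq> carrier (quotient_alg A \<theta>)"
    then have "ys \<in> lists ((\<lambda>a. \<theta> `` {a}) ` carrier A)" unfolding surj by blast
    then obtain xs where xs: "ys = map (\<lambda>a. \<theta> `` {a}) xs" "set xs \<subseteq> carrier A"
      unfolding lists_image by auto
    have "?k (interp (quotient_alg A \<theta>) f ys) = h (interp A f xs)"
      using alg_homD(2)[OF hom, of f xs] f xs k[OF is_algebraD(2)[OF A, of f xs]] by simp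
    also have "\<dots> = interp B f (map h xs)" using alg_homD(2)[OF h, of f xs] f xs by auto
    also have "map h xs = map ?k ys" using xs k by auto
    finally show "?k (interp (quotient_alg A \<theta>) f ys) = interp B f (map ?k ys)" .
  qed
  then show ?thesis using k by (rule that)
qed

lemma rel_cong_factor:
  assumes Q: "quasivariety sg E" and A: "is_algebra sg A" and H: "H \<subseteq> carrier A \<times> carrier A"
    and h: "h \<in> alg_hom sg A B" and B: "in_qv sg E B" and le: "\<And>x y. (x, y) \<in> H \<Longrightarrow> h x = h y"
  obtains k where "k \<in> alg_hom sg (quotient_alg A (rel_cong sg E A H)) B"
    "\<And>a. a \<in> carrier A \<Longrightarrow> k (rel_cong sg E A H `` {a}) = h a"
proof -
  let ?\<theta> = "{(x, y) \<in> carrier A \<times> carrier A. h x = h y}"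
  note c = kernel_congruence[OF h A]
  obtain k where k: "k \<in> alg_hom sg (quotient_alg A ?\<theta>) B"
    "\<And>a. a \<in> carrier A \<Longrightarrow> k (?\<theta> `` {a}) = h a"
    using factor_hom[OF A c h] by blast
  have "inj_on k (carrier (quotient_alg A ?\<theta>))"
    unfolding quotient_hom(2)[OF A c, symmetric]
  proof (rule inj_onI)
    fix C D assume "C \<in> (\<lambda>a. ?\<theta> `` {a}) ` carrier A" "D \<in> (\<lambda>a. ?\<theta> `` {a}) ` carrier A" and kk: "k C = k D"
    then obtain a b where ab: "a \<in> carrier A" "b \<in> carrier A" "C = ?\<theta> `` {a}" "D = ?\<theta> `` {b}" by blast
    then have "h a = h b" using k(2)[of a] k(2)[of b] kk by simp
    then show "C = D" unfolding ab(3,4) using ab(1,2) by auto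
  qed
  then have "in_qv sg E (quotient_alg A ?\<theta>)"
    using in_qv_embed[OF Q k(1) _ quotient_hom(3)[OF A c] B] by simp
  then have "rel_cong sg E A H \<subseteq> ?\<theta>" using c H le unfolding rel_cong_def by blast
  then show ?thesis using factor_hom[OF A rel_cong(1)[OF Q A H] h] that by blast
qed

lemma free_alg:
  assumes Q: "quasivariety sg E" and X: "trms sg X \<noteq> {}"
  shows "in_qv sg E (free_alg sg E X)"
    and "(\<lambda>t. rel_cong sg E (trm_alg sg X) {} `` {t}) \<in> alg_hom sg (trm_alg sg X) (free_alg sg E X)"
    and "(\<lambda>t. rel_cong sg E (trm_alg sg X) {} `` {t}) ` trms sg X = carrier (free_alg sg E X)"
proof -
  note T = trm_alg_algebra[OF X] and c = rel_cong[OF Q trm_alg_algebra[OF X] empty_subsetI]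
  show "in_qv sg E (free_alg sg E X)" unfolding free_alg_def by (rule c(2))
  show "(\<lambda>t. rel_cong sg E (trm_alg sg X) {} `` {t}) \<in> alg_hom sg (trm_alg sg X) (free_alg sg E X)"
    unfolding free_alg_def by (rule quotient_hom(1)[OF T c(1)])
  have "trms sg X = carrier (trm_alg sg X)" by (simp add: trm_alg_def)
  then show "(\<lambda>t. rel_cong sg E (trm_alg sg X) {} `` {t}) ` trms sg X = carrier (free_alg sg E X)"
    unfolding free_alg_def using quotient_hom(2)[OF T c(1)] by simp
qed

lemma free_alg_univ:
  assumes Q: "quasivariety sg E" and X: "trms sg X \<noteq> {}" and A: "in_qv sg E A" and v: "v ` X \<subseteq> carrier A"
  obtains k where "k \<in> alg_hom sg (free_alg sg E X) A"
    "\<And>t. t \<in> trms sg X \<Longrightarrow> k (rel_cong sg E (trm_alg sg X) {} `` {t}) = eval A v t"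
proof -
  have "eval A v \<in> alg_hom sg (trm_alg sg X) A" using eval_is_hom[OF _ v] A by (simp add: in_qv_def)
  then obtain k where "k \<in> alg_hom sg (free_alg sg E X) A"
    "\<And>t. t \<in> carrier (trm_alg sg X) \<Longrightarrow> k (rel_cong sg E (trm_alg sg X) {} `` {t}) = eval A v t"
    unfolding free_alg_def by (rule rel_cong_factor[OF Q trm_alg_algebra[OF X] empty_subsetI _ A]) auto
  moreover have "carrier (trm_alg sg X) = trms sg X" by (simp add: trm_alg_def)
  ultimately show ?thesis by (intro that) auto
qed

lemma free_lift:
  assumes Q: "quasivariety sg E" and X: "trms sg X \<noteq> {}"
    and A: "in_qv sg E A" and B: "in_qv sg E B" and g: "g \<in> alg_hom sg A B" "g ` carrier A = carrier B"
    and f: "f \<in> alg_hom sg (free_alg sg E X) B"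
  shows "\<exists>h \<in> alg_hom sg (free_alg sg E X) A. \<forall>x \<in> carrier (free_alg sg E X). g (h x) = f x"
proof -
  let ?q = "\<lambda>t. rel_cong sg E (trm_alg sg X) {} `` {t}"
  have algA: "is_algebra sg A" using A by (simp add: in_qv_def)
  note F = free_alg[OF Q X]
  have "\<exists>a. a \<in> carrier A \<and> g a = f (?q (Var x))" if "x \<in> X" for x
  proof -
    have "?q (Var x) \<in> carrier (free_alg sg E X)" using F(3) that trms.Var[of x X sg] by blast
    then have "f (?q (Var x)) \<in> g ` carrier A" using alg_homD(1)[OF f] g(2) by auto
    then show ?thesis by force
  qed
  then obtain v where v: "\<And>x. x \<in> X \<Longrightarrow> v x \<in> carrier A \<and> g (v x) = f (?q (Var x))" by metis
  have vX: "v ` X \<subseteq> carrier A" using v by auto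
  obtain k where k: "k \<in> alg_hom sg (free_alg sg E X) A"
    "\<And>t. t \<in> trms sg X \<Longrightarrow> k (?q t) = eval A v t" using free_alg_univ[OF Q X A vX] by blast
  have "g (k (?q t)) = f (?q t)" if t: "t \<in> trms sg X" for t
  proof -
    have hom: "f \<circ> ?q \<in> alg_hom sg (trm_alg sg X) B" by (rule alg_hom_comp[OF F(2) f])
    have ev: "eval B v' t = eval B w t" if "\<And>x. x \<in> X \<Longrightarrow> v' x = w x" for v' w
      using t that by (induction rule: trms.induct) (auto cong: map_cong)
    have "g (k (?q t)) = eval B (g \<circ> v) t" using hom_eval[OF t g(1) algA vX] k(2)[OF t] by simp
    also have "\<dots> = eval B ((f \<circ> ?q) \<circ> Var) t" by (rule ev) (use v in auto)
    also have "\<dots> = (f \<circ> ?q) (eval (trm_alg sg X) Var t)"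
      by (rule hom_eval[OF t hom trm_alg_algebra[OF X], symmetric]) (auto simp: trm_alg_def intro: trms.Var)
    finally show ?thesis by (simp add: eval_trm_alg)
  qed
  then show ?thesis using k(1) unfolding F(3)[symmetric] by blast
qed

lemma free_omega_projective:
  assumes Q: "quasivariety sg E"
  shows "projective sg E (free_omega sg E)"
proof -
  have X: "trms sg (UNIV :: nat set) \<noteq> {}" using trms.Var[of "0 :: nat" UNIV sg] by auto
  show ?thesis unfolding projective_def using free_alg(1)[OF Q X] free_lift[OF Q X] by blast
qed

lemma projective_retract:
  fixes P :: "('f, 'a) algebra"
  assumes Q: "quasivariety sg E" and P: "projective sg E P"
  obtains p h where "p \<in> alg_hom sg (free_alg sg E (carrier P)) P"
    "h \<in> alg_hom sg P (free_alg sg E (carrier P))" "\<And>x. x \<in> carrier P \<Longrightarrow> p (h x) = x"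
proof -
  let ?F = "free_alg sg E (carrier P)"
  have PQ: "in_qv sg E P" and algP: "is_algebra sg P" using P by (auto simp: projective_def in_qv_def)
  have X: "trms sg (carrier P) \<noteq> {}" using is_algebraD(1)[OF algP] trms.Var[of _ "carrier P" sg] by auto
  obtain p where p: "p \<in> alg_hom sg ?F P"
    "\<And>t. t \<in> trms sg (carrier P) \<Longrightarrow> p (rel_cong sg E (trm_alg sg (carrier P)) {} `` {t}) = eval P id t"
    using free_alg_univ[OF Q X PQ, of id] by auto
  have "x \<in> p ` carrier ?F" if "x \<in> carrier P" for x
    unfolding free_alg(3)[OF Q X, symmetric] image_image
    by (rule image_eqI[OF _ trms.Var[OF that]]) (simp add: p(2)[OF trms.Var[OF that]])
  then have surj: "p ` carrier ?F = carrier P" using alg_homD(1)[OF p(1)] by auto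
  let ?m = "\<lambda>x. {Var x} :: ('f, 'a) trm set"
  have "inj_on ?m (carrier P)" by (auto simp: inj_on_def)
  then obtain B where B: "is_algebra sg B" "?m \<in> alg_hom sg P B" "bij_betw ?m (carrier P) (carrier B)"
    using copy_exists[OF _ algP] by blast
  then have "alg_iso sg P B" by (auto simp: alg_iso_def)
  then have BQ: "in_qv sg E B" using in_qv_iso[OF Q alg_iso_sym[OF _ algP] B(1) PQ] by blast
  have "(?m \<circ> p) ` carrier ?F = carrier B" using surj B(3) unfolding bij_betw_def image_comp[symmetric] by simp
  then obtain h where h: "h \<in> alg_hom sg P ?F" "\<forall>x \<in> carrier P. (?m \<circ> p) (h x) = ?m x"
    using P[unfolded projective_def, THEN conjunct2, rule_format,
      OF free_alg(1)[OF Q X] BQ alg_hom_comp[OF p(1) B(2)] _ B(2)] by blast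
  show ?thesis by (rule that[OF p(1) h(1)]) (use h(2) in auto)
qed

lemma projective_any_type:
  assumes Q: "quasivariety sg E" and P: "projective sg E P"
    and A: "in_qv sg E A" and B: "in_qv sg E B" and g: "g \<in> alg_hom sg A B" "g ` carrier A = carrier B"
    and f: "f \<in> alg_hom sg P B"
  shows "\<exists>h \<in> alg_hom sg P A. \<forall>x \<in> carrier P. g (h x) = f x"
proof -
  let ?F = "free_alg sg E (carrier P)"
  have algP: "is_algebra sg P" using P by (auto simp: projective_def in_qv_def)
  have X: "trms sg (carrier P) \<noteq> {}" using is_algebraD(1)[OF algP] trms.Var[of _ "carrier P" sg] by auto
  obtain p h where ph: "p \<in> alg_hom sg ?F P" "h \<in> alg_hom sg P ?F" "\<And>x. x \<in> carrier P \<Longrightarrow> p (h x) = x"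
    using projective_retract[OF Q P] by blast
  obtain k where k: "k \<in> alg_hom sg ?F A" "\<forall>x \<in> carrier ?F. g (k x) = (f \<circ> p) x"
    using free_lift[OF Q X A B g alg_hom_comp[OF ph(1) f]] by blast
  show ?thesis
    using alg_hom_comp[OF ph(2) k(1)] k(2) ph alg_homD(1)[OF ph(2)] by (intro bexI[of _ "k \<circ> h"]) auto
qed

lemma projective_iso:
  assumes Q: "quasivariety sg E" and P: "projective sg E P" and iso: "alg_iso sg P R" and R: "is_algebra sg R"
  shows "projective sg E R"
proof -
  have PQ: "in_qv sg E P" and algP: "is_algebra sg P" using P by (auto simp: projective_def in_qv_def)
  obtain i where i: "i \<in> alg_hom sg P R" "bij_betw i (carrier P) (carrier R)"
    using iso by (auto simp: alg_iso_def)
  define j where "j = inv_into (carrier P) i"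
  have j: "j \<in> alg_hom sg R P" "\<And>x. x \<in> carrier R \<Longrightarrow> i (j x) = x"
    using inverse_hom[OF algP i] i(2) by (auto simp: j_def bij_betw_inv_into_right)
  have "\<exists>h \<in> alg_hom sg R A. \<forall>x \<in> carrier R. g (h x) = f x"
    if A: "in_qv sg E A" and B: "in_qv sg E B" and g: "g \<in> alg_hom sg A B" "g ` carrier A = carrier B"
      and f: "f \<in> alg_hom sg R B" for A :: "('a, ('a, 'c) trm set) algebra" and B :: "('a, ('a, 'c) trm set) algebra" and g f
  proof -
    obtain h where "h \<in> alg_hom sg P A" "\<forall>x \<in> carrier P. g (h x) = (f \<circ> i) x"
      using projective_any_type[OF Q P A B g alg_hom_comp[OF i(1) f]] by blast
    then show ?thesis
      using alg_hom_comp[OF j(1)] j(2) alg_homD(1)[OF j(1)] by (intro bexI[of _ "h \<circ> j"]) auto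
  qed
  moreover have "in_qv sg E R" using in_qv_iso[OF Q alg_iso_sym[OF iso algP] R PQ] .
  ultimately show ?thesis unfolding projective_def by blast
qed

lemma unifiable_any_type:
  fixes A :: "('f, 'a) algebra" and P :: "('f, 'p) algebra"
  assumes Q: "quasivariety sg E" and P: "projective sg E P" and h: "h \<in> alg_hom sg A P"
  shows "unifiable sg E A"
proof -
  have algP: "is_algebra sg P" using P by (auto simp: projective_def in_qv_def)
  have X: "trms sg (carrier P) \<noteq> {}" using is_algebraD(1)[OF algP] trms.Var[of _ "carrier P" sg] by auto
  have U: "trms sg (UNIV :: nat set) \<noteq> {}" using trms.Var[of "0 :: nat" UNIV sg] by auto
  note O = free_alg(1)[OF Q U]
  then obtain c where "c \<in> carrier (free_omega sg E)" by (auto simp: in_qv_def is_algebra_def)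
  then obtain k where k: "k \<in> alg_hom sg (free_alg sg E (carrier P)) (free_omega sg E)"
    using free_alg_univ[OF Q X O, of "\<lambda>_. c"] by (meson image_subsetI)
  obtain r where "r \<in> alg_hom sg P (free_alg sg E (carrier P))"
    using projective_retract[OF Q P] by blast
  then have "k \<circ> (r \<circ> h) \<in> alg_hom sg A (free_omega sg E)" using alg_hom_comp[OF alg_hom_comp[OF h] k] by simp
  then show ?thesis using free_omega_projective[OF Q] unfolding unifiable_def by blast
qed

lemma finitely_presented_fg:
  assumes Q: "quasivariety sg E" and A: "in_qv sg E A" and fp: "finitely_presented sg E A"
  shows "finitely_generated sg A"
proof -
  obtain X :: "nat set" and H where X: "finite X" and
    H: "H \<subseteq> carrier (free_alg sg E X) \<times> carrier (free_alg sg E X)" and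
    iso: "alg_iso sg A (quotient_alg (free_alg sg E X) (rel_cong sg E (free_alg sg E X) H))"
    using fp by (auto simp: finitely_presented_def)
  let ?F = "free_alg sg E X"
  let ?D = "quotient_alg ?F (rel_cong sg E ?F H)"
  have algA: "is_algebra sg A" using A by (simp add: in_qv_def)
  have "carrier ?D \<noteq> {}" using iso is_algebraD(1)[OF algA] by (auto simp: alg_iso_def bij_betw_def)
  then have ne: "trms sg X \<noteq> {}" by (auto simp: quotient_alg_def free_alg_def trm_alg_def)
  note F = free_alg[OF Q ne]
  have algF: "is_algebra sg ?F" using F(1) by (simp add: in_qv_def)
  have "finitely_generated sg ?F"
    using fg_image[OF F(2) _ _ fg_trm_alg[OF X]] F(3) trm_alg_algebra[OF ne]
    by (simp add: is_algebra_def trm_alg_def)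
  then have "finitely_generated sg ?D"
    using fg_image quotient_hom[OF algF rel_cong(1)[OF Q algF H]] algF by (metis is_algebra_def)
  then show ?thesis
    using fg_iso[OF alg_iso_sym[OF iso algA]] rel_cong(2)[OF Q algF H] by (simp add: in_qv_def)
qed

lemma fp_unifiable_copy:
  fixes A :: "('f, 'a) algebra"
  assumes Q: "quasivariety sg E" and A: "in_qv sg E A" and fp: "finitely_presented sg E A"
    and u: "unifiable sg E A"
  obtains B :: "('f, ('f, nat) trm set) algebra"
    where "in_qv sg E B" "finitely_presented sg E B" "unifiable sg E B" "alg_iso sg A B" "alg_iso sg B A"
proof -
  have algA: "is_algebra sg A" using A by (simp add: in_qv_def)
  obtain B :: "('f, ('f, nat) trm set) algebra" where B: "in_qv sg E B" "alg_iso sg A B"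
    using fg_copy[OF Q A finitely_presented_fg[OF Q A fp]] by blast
  note BA = alg_iso_sym[OF B(2) algA]
  have "finitely_presented sg E B"
    using fp alg_iso_trans[OF BA] unfolding finitely_presented_def by blast
  moreover have "unifiable sg E B"
    using u BA alg_hom_comp unfolding unifiable_def alg_iso_def by (metis all_not_in_conv)
  ultimately show ?thesis using that B BA by blast
qed

lemma has_exact_unifiers_any_type:
  fixes A :: "('f, 'a) algebra"
  assumes Q: "quasivariety sg E" and "has_exact_unifiers sg E"
    and A: "in_qv sg E A" "finitely_presented sg E A" "unifiable sg E A"
  shows "exact sg E A"
proof -
  obtain B :: "('f, ('f, nat) trm set) algebra"
    where B: "in_qv sg E B" "finitely_presented sg E B" "unifiable sg E B" "alg_iso sg A B"
    using fp_unifiable_copy[OF Q A] by blast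
  then have "exact sg E B" using assms(2) unfolding has_exact_unifiers_def by blast
  then show ?thesis
    using A(1) finitely_presented_fg[OF Q A(1,2)] alg_iso_trans[OF B(4)] unfolding exact_def by blast
qed

lemma has_projective_unifiers_any_type:
  fixes A :: "('f, 'a) algebra"
  assumes Q: "quasivariety sg E" and "has_projective_unifiers sg E"
    and A: "in_qv sg E A" "finitely_presented sg E A" "unifiable sg E A"
  shows "projective sg E A"
proof -
  obtain B :: "('f, ('f, nat) trm set) algebra"
    where B: "in_qv sg E B" "finitely_presented sg E B" "unifiable sg E B" "alg_iso sg B A"
    using fp_unifiable_copy[OF Q A] by blast
  then have "projective sg E B" using assms(2) unfolding has_projective_unifiers_def by blast
  then show ?thesis using projective_iso[OF Q _ B(4)] A(1) by (simp add: in_qv_def)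
qed

end

theory Submission
  imports Defs
begin

text \<open>
  A finite set \<open>\<Sigma>\<close> of equations in the variables \<open>X\<close> presents the algebra
  \<open>D = F\<^sub>\<Q>(X) / \<theta>\<^sub>\<Q>(\<Sigma>)\<close>: homomorphisms from \<open>D\<close> to a member of \<open>\<Q>\<close> are assignments satisfying \<open>\<Sigma>\<close>,
  so \<open>\<Sigma> \<Rightarrow> \<Delta>\<close> is active iff \<open>D\<close> maps to \<open>F\<^sub>\<Q>(\<omega>)\<close>, i.e. iff \<open>D\<close> is unifiable.

  An embedding of \<open>D\<close> into \<open>F\<^sub>\<Q>(\<omega>)\<close> is a substitution that unifies \<open>\<Sigma>\<close> and only those equations
  that follow from \<open>\<Sigma>\<close> in \<open>\<Q>\<close>; hence exact unifiers make active admissible sentences valid. A finitely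
  generated projective algebra is a retract of \<open>F\<^sub>\<Q>(\<omega>)\<close> and therefore exact.

  Conversely, if \<open>D\<close> is finite, let \<open>\<Delta>\<close> consist of the equations between terms naming
  distinct elements of \<open>D\<close>. Then \<open>\<Sigma> \<Rightarrow> \<Delta>\<close> fails in \<open>D\<close>, so it is not admissible, and a substitution
  witnessing this is an embedding of \<open>D\<close> into \<open>F\<^sub>\<Q>(\<omega>)\<close>.
\<close>

section \<open>Terms, evaluation and substitutions\<close>

lemma trms_mono:
  assumes "t \<in> trms sg X" "X \<subseteq> Y"
  shows "t \<in> trms sg Y"
  using assms by (induction rule: trms.induct) (auto intro: trms.intros)

text \<open>Universal sentences may use any natural number as a variable, while a finite
  presentation needs a finite set of generators; this lemma supplies one.\<close>

lemma trms_finite_support: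
  assumes "t \<in> trms sg Y"
  shows "\<exists>X. finite X \<and> t \<in> trms sg X"
  using assms
proof (induction rule: trms.induct)
  case (Var x)
  then show ?case by (intro exI[of _ "{x}"]) (auto intro: trms.Var)
next
  case (Fun f ts)
  then obtain X where X: "\<And>t. t \<in> set ts \<Longrightarrow> finite (X t) \<and> t \<in> trms sg (X t)" by metis
  have "t \<in> trms sg (\<Union>t\<in>set ts. X t)" if "t \<in> set ts" for t
    using X[OF that] that by (auto intro: trms_mono)
  then show ?case using Fun.hyps(1) X by (intro exI[of _ "\<Union>t\<in>set ts. X t"]) (auto intro: trms.Fun)
qed

lemma eval_agree:
  assumes "t \<in> trms sg X" "\<And>x. x \<in> X \<Longrightarrow> v x = w x"
  shows "eval A v t = eval A w t"
  using assms by (induction rule: trms.induct) (auto cong: map_cong)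

text \<open>A term evaluates to itself in the term algebra under \<open>Var\<close>, so a
  homomorphism out of that algebra is determined by its values on variables. This turns
  substitutions into assignments.\<close>

lemma hom_trm_alg_eval:
  assumes h: "h \<in> alg_hom sg (trm_alg sg X) B" and t: "t \<in> trms sg X"
  shows "h t = eval B (h \<circ> Var) t"
proof -
  have "is_algebra sg (trm_alg sg X)" using t by (intro trm_alg_algebra) auto
  then have "h (eval (trm_alg sg X) Var t) = eval B (h \<circ> Var) t"
    by (rule hom_eval[OF t h]) (auto simp: trm_alg_def intro: trms.Var)
  then show ?thesis by (simp add: eval_trm_alg)
qed

lemma unifies_eval:
  assumes \<sigma>: "\<sigma> \<in> alg_hom sg (trm_alg sg UNIV) B" "unifies \<sigma> \<Sigma>"
    and \<Sigma>: "\<Sigma> \<subseteq> trms sg UNIV \<times> trms sg UNIV"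
  shows "\<forall>(s, t) \<in> \<Sigma>. eval B (\<sigma> \<circ> Var) s = eval B (\<sigma> \<circ> Var) t"
proof clarify
  fix s t assume st: "(s, t) \<in> \<Sigma>"
  then have "s \<in> trms sg UNIV" "t \<in> trms sg UNIV" "\<sigma> s = \<sigma> t"
    using \<Sigma> \<sigma>(2) by (auto simp: unifies_def)
  then show "eval B (\<sigma> \<circ> Var) s = eval B (\<sigma> \<circ> Var) t"
    using hom_trm_alg_eval[OF \<sigma>(1)] by metis
qed

lemma trms_UNIV_nonempty: "trms sg (UNIV :: 'v set) \<noteq> {}"
  using trms.Var[of undefined UNIV sg] by auto

lemma rel_cong_superset: "H \<subseteq> rel_cong sg E A H"
  by (auto simp: rel_cong_def)

section \<open>Algebras presented by equations between terms\<close>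

definition gen_class ::
  "'f signature \<Rightarrow> 'f usentence set \<Rightarrow> 'v set \<Rightarrow> ('f, 'v) trm \<Rightarrow> ('f, 'v) trm set" where
  "gen_class sg E X t = rel_cong sg E (trm_alg sg X) {} `` {t}"

text \<open>Relations are pairs of terms rather than of elements of the free algebra, so that the
  premises of a universal sentence serve directly as relations.\<close>

definition presented_alg ::
  "'f signature \<Rightarrow> 'f usentence set \<Rightarrow> 'v set \<Rightarrow> (('f, 'v) trm \<times> ('f, 'v) trm) set \<Rightarrow>
    ('f, ('f, 'v) trm set set) algebra" where
  "presented_alg sg E X \<Sigma> = quotient_alg (free_alg sg E X)
     (rel_cong sg E (free_alg sg E X) (map_prod (gen_class sg E X) (gen_class sg E X) ` \<Sigma>))"

definition presented_class ::
  "'f signature \<Rightarrow> 'f usentence set \<Rightarrow> 'v set \<Rightarrow> (('f, 'v) trm \<times> ('f, 'v) trm) set \<Rightarrow>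
    ('f, 'v) trm \<Rightarrow> ('f, 'v) trm set set" where
  "presented_class sg E X \<Sigma> t = rel_cong sg E (free_alg sg E X)
     (map_prod (gen_class sg E X) (gen_class sg E X) ` \<Sigma>) `` {gen_class sg E X t}"

text \<open>The last item is the universal property: an assignment extends to the free algebra, and
  if it satisfies the relations, the extension factors through the quotient.\<close>

lemma presented_alg:
  assumes Q: "quasivariety sg E" and X: "trms sg X \<noteq> {}" and \<Sigma>: "\<Sigma> \<subseteq> trms sg X \<times> trms sg X"
  shows "in_qv sg E (presented_alg sg E X \<Sigma>)"
    and "presented_class sg E X \<Sigma> \<in> alg_hom sg (trm_alg sg X) (presented_alg sg E X \<Sigma>)"
    and "presented_class sg E X \<Sigma> ` trms sg X = carrier (presented_alg sg E X \<Sigma>)"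
    and "(s, t) \<in> \<Sigma> \<Longrightarrow> presented_class sg E X \<Sigma> s = presented_class sg E X \<Sigma> t"
    and "in_qv sg E B \<Longrightarrow> w ` X \<subseteq> carrier B \<Longrightarrow> \<forall>(s, t) \<in> \<Sigma>. eval B w s = eval B w t \<Longrightarrow>
      \<exists>k \<in> alg_hom sg (presented_alg sg E X \<Sigma>) B.
        \<forall>t \<in> trms sg X. k (presented_class sg E X \<Sigma> t) = eval B w t"
proof -
  let ?q = "gen_class sg E X" and ?F = "free_alg sg E X"
  let ?H = "map_prod ?q ?q ` \<Sigma>"
  let ?r = "\<lambda>a. rel_cong sg E ?F ?H `` {a}"
  have FQ: "in_qv sg E ?F" and qhom: "?q \<in> alg_hom sg (trm_alg sg X) ?F"
    and qim: "?q ` trms sg X = carrier ?F"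
    using free_alg[OF Q X] unfolding gen_class_def[abs_def] by auto
  have F: "is_algebra sg ?F" using FQ by (simp add: in_qv_def)
  have H: "?H \<subseteq> carrier ?F \<times> carrier ?F" using \<Sigma> unfolding qim[symmetric] by auto
  note c = rel_cong[OF Q F H]
  note r = quotient_hom[OF F c(1)]
  have p: "presented_class sg E X \<Sigma> = ?r \<circ> ?q" by (simp add: presented_class_def fun_eq_iff)
  show "in_qv sg E (presented_alg sg E X \<Sigma>)" unfolding presented_alg_def by (rule c(2))
  show "presented_class sg E X \<Sigma> \<in> alg_hom sg (trm_alg sg X) (presented_alg sg E X \<Sigma>)"
    unfolding p presented_alg_def by (rule alg_hom_comp[OF qhom r(1)])
  show "presented_class sg E X \<Sigma> ` trms sg X = carrier (presented_alg sg E X \<Sigma>)"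
    unfolding p presented_alg_def image_comp[symmetric] qim r(2) ..
  show "presented_class sg E X \<Sigma> s = presented_class sg E X \<Sigma> t" if "(s, t) \<in> \<Sigma>"
  proof -
    have "(?q s, ?q t) \<in> ?H" using imageI[OF that, of "map_prod ?q ?q"] by simp
    then have "(?q s, ?q t) \<in> rel_cong sg E ?F ?H" by (rule subsetD[OF rel_cong_superset])
    moreover have "equiv (carrier ?F) (rel_cong sg E ?F ?H)" using c(1) by (simp add: congruence_def)
    ultimately show ?thesis unfolding presented_class_def by (metis equiv_class_eq)
  qed
  assume B: "in_qv sg E B" and w: "w ` X \<subseteq> carrier B" and sat: "\<forall>(s, t) \<in> \<Sigma>. eval B w s = eval B w t"
  obtain g where g: "g \<in> alg_hom sg ?F B" "\<And>t. t \<in> trms sg X \<Longrightarrow> g (?q t) = eval B w t"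
    using free_alg_univ[OF Q X B w] unfolding gen_class_def[abs_def] by blast
  have "g x = g y" if xy: "(x, y) \<in> ?H" for x y
  proof -
    obtain s t where st: "(s, t) \<in> \<Sigma>" "x = ?q s" "y = ?q t" using xy by auto
    then have "s \<in> trms sg X" "t \<in> trms sg X" "eval B w s = eval B w t" using \<Sigma> sat by auto
    then show ?thesis using st(2,3) g(2) by simp
  qed
  then obtain k where "k \<in> alg_hom sg (presented_alg sg E X \<Sigma>) B"
    "\<And>a. a \<in> carrier ?F \<Longrightarrow> k (?r a) = g a"
    using rel_cong_factor[OF Q F H g(1) B] unfolding presented_alg_def by blast
  then show "\<exists>k \<in> alg_hom sg (presented_alg sg E X \<Sigma>) B.
        \<forall>t \<in> trms sg X. k (presented_class sg E X \<Sigma> t) = eval B w t"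
    using g(2) imageI[of _ "trms sg X" ?q] unfolding p qim[symmetric]
    by (intro bexI[of _ k]) auto
qed

lemma alg_iso_refl: "alg_iso sg A A"
  unfolding alg_iso_def by (intro bexI[of _ id] alg_homI) auto

lemma finitely_presented_presented_alg:
  fixes X :: "nat set"
  assumes Q: "quasivariety sg E" and X: "finite X" "trms sg X \<noteq> {}"
    and \<Sigma>: "finite \<Sigma>" "\<Sigma> \<subseteq> trms sg X \<times> trms sg X"
  shows "finitely_presented sg E (presented_alg sg E X \<Sigma>)"
proof -
  let ?H = "map_prod (gen_class sg E X) (gen_class sg E X) ` \<Sigma>"
  have "?H \<subseteq> carrier (free_alg sg E X) \<times> carrier (free_alg sg E X)"
    using \<Sigma>(2) free_alg(3)[OF Q X(2)] unfolding gen_class_def[abs_def] by auto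
  then show ?thesis
    using X(1) \<Sigma>(1) alg_iso_refl unfolding finitely_presented_def presented_alg_def
    by (intro exI[of _ X] exI[of _ ?H] conjI) auto
qed

text \<open>A finite set of pairs of classes is the image of a finite set of pairs of terms: one
  preimage is chosen for each pair.\<close>

lemma finitely_presented_obtain:
  assumes Q: "quasivariety sg E" and A: "is_algebra sg A" and fp: "finitely_presented sg E A"
  obtains X :: "nat set" and \<Sigma> where "trms sg X \<noteq> {}" "finite \<Sigma>" "\<Sigma> \<subseteq> trms sg X \<times> trms sg X"
    "alg_iso sg A (presented_alg sg E X \<Sigma>)"
proof -
  obtain X :: "nat set" and H where H: "finite H"
    "H \<subseteq> carrier (free_alg sg E X) \<times> carrier (free_alg sg E X)" and
    iso: "alg_iso sg A (quotient_alg (free_alg sg E X) (rel_cong sg E (free_alg sg E X) H))"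
    using fp by (auto simp: finitely_presented_def)
  let ?q = "gen_class sg E X"
  have "carrier (quotient_alg (free_alg sg E X) (rel_cong sg E (free_alg sg E X) H)) \<noteq> {}"
    using iso is_algebraD(1)[OF A] by (auto simp: alg_iso_def bij_betw_def)
  then have X: "trms sg X \<noteq> {}" by (auto simp: quotient_alg_def free_alg_def trm_alg_def)
  have "H \<subseteq> map_prod ?q ?q ` (trms sg X \<times> trms sg X)"
    using H(2) free_alg(3)[OF Q X] unfolding gen_class_def[abs_def] map_prod_surj_on[OF refl refl]
    by simp
  then obtain \<Sigma> where "\<Sigma> \<subseteq> trms sg X \<times> trms sg X" "finite \<Sigma>" "H = map_prod ?q ?q ` \<Sigma>"
    using finite_subset_image[OF H(1)] by blast
  then show ?thesis using that X iso unfolding presented_alg_def by blast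
qed

section \<open>Homomorphisms and embeddings into F_Q(omega)\<close>

lemma unifiable_hom_free_omega:
  assumes Q: "quasivariety sg E" and "unifiable sg E A"
  obtains h where "h \<in> alg_hom sg A (free_omega sg E)"
proof -
  obtain P :: "('a, ('a, nat) trm set) algebra" and g
    where P: "projective sg E P" and g: "g \<in> alg_hom sg A P"
    using assms(2) unfolding unifiable_def by blast
  have "is_algebra sg P" using P by (simp add: projective_def in_qv_def)
  then have X: "trms sg (carrier P) \<noteq> {}"
    using is_algebraD(1) trms.Var[of _ "carrier P" sg] by fastforce
  \<comment> \<open>The free algebra on \<open>carrier P\<close> may have uncountably many
    generators; sending all of them to one element \<open>c\<close> still gives a homomorphism into
    F_Q(omega).\<close>
  note O = free_alg(1)[OF Q trms_UNIV_nonempty[where 'v = nat]]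
  then obtain c where "c \<in> carrier (free_omega sg E)" by (auto simp: in_qv_def is_algebra_def)
  then obtain k where "k \<in> alg_hom sg (free_alg sg E (carrier P)) (free_omega sg E)"
    using free_alg_univ[OF Q X O, of "\<lambda>_. c"] by (meson image_subsetI)
  moreover obtain h where "h \<in> alg_hom sg P (free_alg sg E (carrier P))"
    using projective_retract[OF Q P] by blast
  ultimately show ?thesis using alg_hom_comp[OF alg_hom_comp[OF g]] that by blast
qed

text \<open>Trades subalgebras for injective homomorphisms, which substitutions provide more
  directly: the image of such a homomorphism is the required subalgebra.\<close>

lemma exact_iff_embedding:
  assumes "in_qv sg E A" "finitely_generated sg A"
  shows "exact sg E A \<longleftrightarrow> (\<exists>h \<in> alg_hom sg A (free_omega sg E). inj_on h (carrier A))"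
proof
  assume "exact sg E A"
  then obtain B h where "subalgebra sg B (free_omega sg E)"
    "h \<in> alg_hom sg A B" "bij_betw h (carrier A) (carrier B)"
    unfolding exact_def alg_iso_def by blast
  then show "\<exists>h \<in> alg_hom sg A (free_omega sg E). inj_on h (carrier A)"
    by (intro bexI[of _ h])
      (auto simp: subalgebra_def subuniverse_def alg_hom_def bij_betw_def)
next
  assume "\<exists>h \<in> alg_hom sg A (free_omega sg E). inj_on h (carrier A)"
  then obtain h where h: "h \<in> alg_hom sg A (free_omega sg E)" "inj_on h (carrier A)" by blast
  have A: "is_algebra sg A" using assms by (simp add: in_qv_def)
  let ?B = "(free_omega sg E)\<lparr>carrier := h ` carrier A\<rparr>"
  have "interp (free_omega sg E) f ys \<in> h ` carrier A"
    if f: "sg f = Some (length ys)" "set ys \<subseteq> h ` carrier A" for f ys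
  proof -
    from f(2) have "ys \<in> lists (h ` carrier A)" by auto
    then obtain xs where xs: "ys = map h xs" "set xs \<subseteq> carrier A" unfolding lists_image by auto
    then have "interp (free_omega sg E) f ys = h (interp A f xs)" "interp A f xs \<in> carrier A"
      using alg_homD(2)[OF h(1), of f xs] is_algebraD(2)[OF A, of f xs] f(1) by simp_all
    then show ?thesis by simp
  qed
  then have "subalgebra sg ?B (free_omega sg E)"
    using alg_homD(1)[OF h(1)] is_algebraD(1)[OF A] by (auto simp: subalgebra_def subuniverse_def)
  moreover have "h \<in> alg_hom sg A ?B" using alg_homD[OF h(1)] by (intro alg_homI) auto
  moreover have "bij_betw h (carrier A) (carrier ?B)" using h(2) by (simp add: bij_betw_def)
  ultimately show "exact sg E A" using assms unfolding exact_def alg_iso_def by blast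
qed

text \<open>A generating sequence gives a surjection from F_Q(omega); lifting the identity along it
  yields a section, which is injective.\<close>

lemma projective_imp_exact:
  fixes A :: "('f, 'a) algebra"
  assumes Q: "quasivariety sg E" and P: "projective sg E A" and fg: "finitely_generated sg A"
  shows "exact sg E A"
proof -
  have AQ: "in_qv sg E A" and A: "is_algebra sg A" using P by (auto simp: projective_def in_qv_def)
  let ?F = "free_omega sg E"
  obtain v :: "nat \<Rightarrow> 'a" where v: "range v \<subseteq> carrier A" "eval A v ` trms sg UNIV = carrier A"
    using fg_eval[OF A fg] by blast
  note F = free_alg[OF Q trms_UNIV_nonempty[where 'v = nat]]
  obtain k where k: "k \<in> alg_hom sg ?F A"
    "\<And>t. t \<in> trms sg UNIV \<Longrightarrow> k (rel_cong sg E (trm_alg sg UNIV) {} `` {t}) = eval A v t"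
    using free_alg_univ[OF Q trms_UNIV_nonempty AQ v(1)] by blast
  have "k ` carrier ?F = carrier A"
    unfolding F(3)[symmetric] v(2)[symmetric] image_image using k(2) by auto
  moreover have "id \<in> alg_hom sg A A" by (rule alg_homI) auto
  ultimately obtain h where h: "h \<in> alg_hom sg A ?F" "\<forall>x \<in> carrier A. k (h x) = id x"
    using projective_any_type[OF Q P F(1) AQ k(1)] by blast
  have "inj_on h (carrier A)" using h(2) by (metis id_apply inj_onI)
  then show ?thesis using h(1) exact_iff_embedding[OF AQ fg] by blast
qed

section \<open>From exact unifiers to active universal completeness\<close>

lemma exact_unifiers_imp_active_universally_complete:
  fixes sg :: "'f signature"
  assumes Q: "quasivariety sg E" and ex: "has_exact_unifiers sg E"
  shows "active_universally_complete sg E"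
  unfolding active_universally_complete_def
proof (intro allI impI)
  fix \<phi> :: "'f usentence"
  assume us: "universal_sentence sg \<phi>" and act: "active sg E \<phi>" and adm: "admissible sg E \<phi>"
  let ?F = "free_omega sg E"
  note FQ = free_alg(1)[OF Q trms_UNIV_nonempty[where 'v = nat]]
  then have F: "is_algebra sg ?F" by (simp add: in_qv_def)
  define T where "T = fst ` (fst \<phi> \<union> snd \<phi>) \<union> snd ` (fst \<phi> \<union> snd \<phi>)"
  have T: "finite T" "T \<subseteq> trms sg UNIV" using us by (auto simp: T_def universal_sentence_def)
  then obtain Y where Y: "\<And>t. t \<in> T \<Longrightarrow> finite (Y t) \<and> t \<in> trms sg (Y t)"
    using trms_finite_support by (metis subsetD)
  \<comment> \<open>Adding 0 guarantees terms over \<open>X\<close> even for a sentence without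
    equations; 0 is also the default variable in \<open>u\<close> below.\<close>
  define X :: "nat set" where "X = insert 0 (\<Union>t\<in>T. Y t)"
  have X: "finite X" "0 \<in> X" using T Y by (auto simp: X_def)
  have "t \<in> trms sg X" if "t \<in> T" for t using Y[OF that] that by (auto simp: X_def intro: trms_mono)
  then have TX: "s \<in> trms sg X \<and> t \<in> trms sg X" if "(s, t) \<in> fst \<phi> \<union> snd \<phi>" for s t
    using that unfolding T_def by force
  have X': "trms sg X \<noteq> {}" using trms.Var[OF X(2), of sg] by blast
  have \<Sigma>: "finite (fst \<phi>)" "fst \<phi> \<subseteq> trms sg X \<times> trms sg X"
    using us TX by (auto simp: universal_sentence_def)
  let ?D = "presented_alg sg E X (fst \<phi>)" and ?p = "presented_class sg E X (fst \<phi>)"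
  note D = presented_alg[OF Q X' \<Sigma>(2)]
  have fp: "finitely_presented sg E ?D" by (rule finitely_presented_presented_alg[OF Q X(1) X' \<Sigma>])
  obtain \<sigma> where \<sigma>: "\<sigma> \<in> alg_hom sg (trm_alg sg UNIV) ?F" "unifies \<sigma> (fst \<phi>)"
    using act unfolding active_def substitutions_def by blast
  \<comment> \<open>Read as an assignment, the unifier factors through \<open>?D\<close>; the
    resulting homomorphism into F_Q(omega) makes \<open>?D\<close> unifiable.\<close>
  have "\<forall>(s, t) \<in> fst \<phi>. eval ?F (\<sigma> \<circ> Var) s = eval ?F (\<sigma> \<circ> Var) t"
    by (rule unifies_eval[OF \<sigma>]) (use us in \<open>simp add: universal_sentence_def\<close>)
  moreover have "(\<sigma> \<circ> Var) ` X \<subseteq> carrier ?F"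
    using alg_homD(1)[OF \<sigma>(1)] by (auto simp: trm_alg_def intro: trms.Var)
  ultimately obtain k where "k \<in> alg_hom sg ?D ?F" using D(5)[OF FQ] by blast
  then have "unifiable sg E ?D" by (rule unifiable_any_type[OF Q free_omega_projective[OF Q]])
  then have "exact sg E ?D" by (rule has_exact_unifiers_any_type[OF Q ex D(1) fp])
  then obtain e where e: "e \<in> alg_hom sg ?D ?F" "inj_on e (carrier ?D)"
    using exact_iff_embedding[OF D(1) finitely_presented_fg[OF Q D(1) fp]] by blast
  \<comment> \<open>The embedding \<open>e\<close> is read as an assignment. A substitution must
    cover all variables, so those outside \<open>X\<close> get the value of variable 0.\<close>
  define u where "u x = e (?p (Var (if x \<in> X then x else 0)))" for x
  have ep: "e \<circ> ?p \<in> alg_hom sg (trm_alg sg X) ?F" by (rule alg_hom_comp[OF D(2) e(1)])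
  have u: "range u \<subseteq> carrier ?F"
    using alg_homD(1)[OF ep] X(2) by (auto simp: u_def trm_alg_def trms.Var)
  have ue: "eval ?F u t = e (?p t)" if "t \<in> trms sg X" for t
    using hom_trm_alg_eval[OF ep that] eval_agree[OF that, of u "(e \<circ> ?p) \<circ> Var" ?F]
    by (simp add: u_def)
  have "eval ?F u \<in> substitutions sg E"
    unfolding substitutions_def by (rule eval_is_hom[OF F u])
  moreover have "eval ?F u s = eval ?F u t" if "(s, t) \<in> fst \<phi>" for s t
    using D(4)[OF that] TX[of s t] that by (simp add: ue)
  then have "unifies (eval ?F u) (fst \<phi>)" unfolding unifies_def by blast
  ultimately have "\<exists>e \<in> snd \<phi>. unifies (eval ?F u) {e}"
    using adm unfolding admissible_def by blast
  then obtain s t where st: "(s, t) \<in> snd \<phi>" "eval ?F u s = eval ?F u t"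
    by (auto simp: unifies_def)
  have stX: "s \<in> trms sg X" "t \<in> trms sg X" using TX st(1) by auto
  \<comment> \<open>Injectivity of \<open>e\<close> pulls the unified conclusion back to
    \<open>?D\<close>, where it becomes a consequence of the premises.\<close>
  have pst: "?p s = ?p t"
    using st(2) ue stX e(2) D(3) by (metis image_eqI inj_onD)
  show "valid_in_qv sg E \<phi>"
    unfolding valid_in_qv_def valid_in_def
  proof (intro allI impI)
    fix A :: "('f, ('f, nat) trm set) algebra" and v
    assume A: "in_qv sg E A" and v: "range v \<subseteq> carrier A"
      and sat: "\<forall>(s, t) \<in> fst \<phi>. eval A v s = eval A v t"
    \<comment> \<open>Every assignment satisfying the premises factors through \<open>?D\<close>, so
      the equality of the classes of \<open>s\<close> and \<open>t\<close> transfers to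
      \<open>A\<close>.\<close>
    have "v ` X \<subseteq> carrier A" using v by auto
    then obtain k where "\<forall>t \<in> trms sg X. k (?p t) = eval A v t" using D(5)[OF A _ sat] by blast
    then have "eval A v s = eval A v t" using pst stX by metis
    then show "\<exists>(s, t) \<in> snd \<phi>. eval A v s = eval A v t" using st(1) by blast
  qed
qed

section \<open>The converse for finite algebras\<close>

lemma active_universally_complete_imp_exact:
  fixes A :: "('f, ('f, nat) trm set) algebra"
  assumes Q: "quasivariety sg E" and auc: "active_universally_complete sg E"
    and AQ: "in_qv sg E A" and fin: "finite (carrier A)"
    and fp: "finitely_presented sg E A" and unif: "unifiable sg E A"
  shows "exact sg E A"
proof -
  let ?F = "free_omega sg E"
  note FQ = free_alg(1)[OF Q trms_UNIV_nonempty[where 'v = nat]]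
  have A: "is_algebra sg A" using AQ by (simp add: in_qv_def)
  obtain X :: "nat set" and \<Sigma> where X: "trms sg X \<noteq> {}"
    and \<Sigma>: "finite \<Sigma>" "\<Sigma> \<subseteq> trms sg X \<times> trms sg X" and iso: "alg_iso sg A (presented_alg sg E X \<Sigma>)"
    using finitely_presented_obtain[OF Q A fp] by blast
  let ?D = "presented_alg sg E X \<Sigma>" and ?p = "presented_class sg E X \<Sigma>"
  note D = presented_alg[OF Q X \<Sigma>(2)]
  obtain i where i: "i \<in> alg_hom sg A ?D" "bij_betw i (carrier A) (carrier ?D)"
    using iso unfolding alg_iso_def by blast
  obtain j where j: "j \<in> alg_hom sg ?D A" "bij_betw j (carrier ?D) (carrier A)"
    using alg_iso_sym[OF iso A] unfolding alg_iso_def by blast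
  have jp: "j \<circ> ?p \<in> alg_hom sg (trm_alg sg X) A" by (rule alg_hom_comp[OF D(2) j(1)])
  obtain a where a: "a \<in> carrier A" using is_algebraD(1)[OF A] by blast
  \<comment> \<open>\<open>v\<close> carries the presentation over to \<open>A\<close>;
    \<open>a\<close> is an arbitrary value for the variables outside \<open>X\<close>.\<close>
  define v where "v x = (if x \<in> X then j (?p (Var x)) else a)" for x
  have v: "range v \<subseteq> carrier A"
    using alg_homD(1)[OF jp] a by (auto simp: v_def trm_alg_def trms.Var)
  have vj: "eval A v t = j (?p t)" if "t \<in> trms sg X" for t
    using hom_trm_alg_eval[OF jp that] eval_agree[OF that, of v "(j \<circ> ?p) \<circ> Var" A]
    by (simp add: v_def)
  have sub: "t \<in> trms sg UNIV" if "t \<in> trms sg X" for t using trms_mono[OF that] by simp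
  have "\<forall>d \<in> carrier ?D. \<exists>t \<in> trms sg X. ?p t = d" unfolding D(3)[symmetric] by blast
  then obtain r where r: "\<And>d. d \<in> carrier ?D \<Longrightarrow> r d \<in> trms sg X \<and> ?p (r d) = d" by metis
  \<comment> \<open>If \<open>?D\<close> has one element, \<open>\<Delta>\<close> is empty: the
    sentence then fails wherever its premises hold, and \<open>k\<close> below is trivially
    injective.\<close>
  define \<Delta> where "\<Delta> = {(r c, r d) | c d. c \<in> carrier ?D \<and> d \<in> carrier ?D \<and> c \<noteq> d}"
  have "finite (carrier ?D)" using fin i(2) by (simp add: bij_betw_finite)
  moreover have "\<Delta> \<subseteq> map_prod r r ` (carrier ?D \<times> carrier ?D)" by (auto simp: \<Delta>_def)
  ultimately have "finite \<Delta>" by (meson finite_SigmaI finite_imageI finite_subset)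
  moreover have "\<Delta> \<subseteq> trms sg UNIV \<times> trms sg UNIV" "\<Sigma> \<subseteq> trms sg UNIV \<times> trms sg UNIV"
    using r \<Sigma>(2) sub by (auto simp: \<Delta>_def)
  ultimately have us: "universal_sentence sg (\<Sigma>, \<Delta>)"
    using \<Sigma>(1) by (simp add: universal_sentence_def)
  have "eval A v s = eval A v t" if "(s, t) \<in> \<Sigma>" for s t
    using D(4)[OF that] subsetD[OF \<Sigma>(2) that] by (simp add: vj)
  then have sat: "\<forall>(s, t) \<in> \<Sigma>. eval A v s = eval A v t" by blast
  have "eval A v (r c) \<noteq> eval A v (r d)" if "c \<in> carrier ?D" "d \<in> carrier ?D" "c \<noteq> d" for c d
    using that r vj j(2) by (metis bij_betw_def inj_onD)
  then have "\<not> (\<exists>(s, t) \<in> \<Delta>. eval A v s = eval A v t)" by (auto simp: \<Delta>_def)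
  then have "\<not> valid_in A (\<Sigma>, \<Delta>)" using v sat unfolding valid_in_def by auto
  then have "\<not> valid_in_qv sg E (\<Sigma>, \<Delta>)" using AQ unfolding valid_in_qv_def by blast
  moreover have "active sg E (\<Sigma>, \<Delta>)"
  proof -
    \<comment> \<open>Since \<open>v\<close> satisfies \<open>\<Sigma>\<close>, following it by any
      homomorphism into F_Q(omega) gives a unifier.\<close>
    obtain h where "h \<in> alg_hom sg A ?F" using unifiable_hom_free_omega[OF Q unif] by blast
    then have "h \<circ> eval A v \<in> substitutions sg E"
      unfolding substitutions_def using alg_hom_comp[OF eval_is_hom[OF A v]] by blast
    moreover have "unifies (h \<circ> eval A v) \<Sigma>" using sat unfolding unifies_def by auto
    ultimately show ?thesis unfolding active_def by auto
  qed
  ultimately have "\<not> admissible sg E (\<Sigma>, \<Delta>)"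
    using auc us unfolding active_universally_complete_def by blast
  then obtain \<sigma> where \<sigma>: "\<sigma> \<in> alg_hom sg (trm_alg sg UNIV) ?F" "unifies \<sigma> \<Sigma>"
    and not_unif: "\<forall>e \<in> \<Delta>. \<not> unifies \<sigma> {e}"
    unfolding admissible_def substitutions_def by auto
  have sep: "\<sigma> s \<noteq> \<sigma> t" if "(s, t) \<in> \<Delta>" for s t
    using bspec[OF not_unif that] by (simp add: unifies_def)
  note ev = hom_trm_alg_eval[OF \<sigma>(1) sub]
  have "\<forall>(s, t) \<in> \<Sigma>. eval ?F (\<sigma> \<circ> Var) s = eval ?F (\<sigma> \<circ> Var) t"
    by (rule unifies_eval[OF \<sigma>]) (use us in \<open>simp add: universal_sentence_def\<close>)
  moreover have "(\<sigma> \<circ> Var) ` X \<subseteq> carrier ?F"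
    using alg_homD(1)[OF \<sigma>(1)] by (auto simp: trm_alg_def intro: trms.Var)
  ultimately obtain k where k: "k \<in> alg_hom sg ?D ?F"
    "\<forall>t \<in> trms sg X. k (?p t) = eval ?F (\<sigma> \<circ> Var) t"
    using D(5)[OF FQ, of "\<sigma> \<circ> Var"] by auto
  \<comment> \<open>\<open>k\<close> acts on representatives as \<open>\<sigma>\<close> does, so
    identifying two distinct elements would make \<open>\<sigma>\<close> unify an equation of
    \<open>\<Delta>\<close>.\<close>
  have kr: "k d = \<sigma> (r d)" if "d \<in> carrier ?D" for d using r[OF that] k(2) ev by metis
  have "inj_on k (carrier ?D)"
  proof (rule inj_onI, rule ccontr)
    fix c d assume cd: "c \<in> carrier ?D" "d \<in> carrier ?D" "k c = k d" "c \<noteq> d"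
    then have "(r c, r d) \<in> \<Delta>" unfolding \<Delta>_def by blast
    then show False using sep cd kr by metis
  qed
  then have "inj_on (k \<circ> i) (carrier A)" using i(2) by (auto simp: bij_betw_def intro: comp_inj_on)
  then show ?thesis
    using alg_hom_comp[OF i(1) k(1)] exact_iff_embedding[OF AQ finitely_presented_fg[OF Q AQ fp]]
    by blast
qed

theorem theorem3p22:
  fixes sg :: "'f signature" and E :: "'f usentence set"
  assumes "quasivariety sg E"
  shows "(has_exact_unifiers sg E \<or> has_projective_unifiers sg E
            \<longrightarrow> active_universally_complete sg E) \<and>
         (locally_finite sg E
            \<longrightarrow> (active_universally_complete sg E \<longleftrightarrow> has_exact_unifiers sg E))"
proof (intro conjI impI iffI)
  note Q = assms
  have "has_exact_unifiers sg E" if "has_projective_unifiers sg E"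
    using that projective_imp_exact[OF Q] finitely_presented_fg[OF Q]
    unfolding has_exact_unifiers_def has_projective_unifiers_def by blast
  then show "active_universally_complete sg E"
    if "has_exact_unifiers sg E \<or> has_projective_unifiers sg E"
    using that exact_unifiers_imp_active_universally_complete[OF Q] by blast
  show "active_universally_complete sg E" if "has_exact_unifiers sg E"
    using that by (rule exact_unifiers_imp_active_universally_complete[OF Q])
  \<comment> \<open>Finitely presented algebras are finitely generated, so local finiteness makes
    them finite, which is what makes \<open>\<Delta>\<close> a finite set.\<close>
  show "has_exact_unifiers sg E" if "locally_finite sg E" "active_universally_complete sg E"
    using that active_universally_complete_imp_exact[OF Q] finitely_presented_fg[OF Q]
    unfolding has_exact_unifiers_def locally_finite_def by blast
qed

end
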